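(* Let $a,b>0$. For $\gamma\in\mathbb{R}\setminus\{-b,0,a\}$ such that billiard trajectories within the ellipse $\frac{x^2}{a}+\frac{y^2}{b}=1$ in the Minkowski plane with caustic $\frac{x^2}{a-\gamma}+\frac{y^2}{b+\gamma}=1$ are $3$-periodic, let $\hat p_3$ be a real polynomial of degree $3$ for which there is a real polynomial $\hat q_1$ of degree $1$ with $$\hat p_3^2(s)-s\left(s-\frac1a\right)\left(s+\frac1b\right)\left(s-\frac1\gamma\right)\hat q_1^2(s)=1.$$ (1) For $\gamma\in(-b,0)$, i.e. $\gamma=-\frac{ab}{(a+b)^2}\left(-a+b+2\sqrt{a^2+ab+b^2}\right)$, the polynomial $\hat p_3$ is, up to a constant factor, equal to $$TA_3\left(2a\left(1-\operatorname{sn}^2\tfrac K3\right)s+2\operatorname{sn}^2\tfrac K3-1;\,2,\kappa\right),$$ where the modulus $\kappa\in(0,1)$ is determined by $\dfrac ba=\dfrac{1-\operatorname{sn}^2\frac K3}{\operatorname{sn}^2\frac{2K}3+\operatorname{sn}^2\frac K3-1}$. (2) For $\gamma\in(0,a)$, i.e. $\gamma=\frac{ab}{(a+b)^2}\left(a-b+2\sqrt{a^2+ab+b^2}\right)$, the polynomial $\hat p_3$ is, up to a constant factor, equal to $$TA_3\left(2b\left(1-\operatorname{sn}^2\tfrac K3\right)s+1-2\operatorname{sn}^2\tfrac K3;\,1,\kappa\right),$$ where the modulus $\kappa\in(0,1)$ is determined by $\dfrac ba=\dfrac{\operatorname{sn}^2\frac{2K}3+\operatorname{sn}^2\frac K3-1}{1-\operatorname{sn}^2\frac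 K3}$.
   Context: $\operatorname{sn}$ is the Jacobi elliptic sine with modulus $\kappa$ and $K=K(\kappa)$ is the complete elliptic integral of the first kind. Akhiezer polynomials: for integers $0<m<n$ and $\kappa\in(0,1)$ put $$\alpha=1-2\operatorname{sn}^2\left(\tfrac mnK\right),\qquad \beta=2\operatorname{sn}^2\left(\tfrac{n-m}{n}K\right)-1.$$ $TA_n(x,m,\kappa)$ (also written $TA_n(x;m,\kappa)$) is the Akhiezer polynomial on $[-1,\alpha]\cup[\beta,1]$: the monic polynomial of degree $n$ in $x$ of least uniform norm $L$ on $[-1,\alpha]\cup[\beta,1]$. By Akhiezer's theorem it is characterized as the monic polynomial of degree $n$ with maximum modulus $L$ on $[-1,\alpha]\cup[\beta,1]$ that takes the values $\pm L$ with alternating signs at $n-m+1$ consecutive points of $[-1,\alpha]$ and at $m+1$ consecutive points of $[\beta,1]$. Billiards: the Minkowski plane is $\mathbb{R}^2$ with $\langle X,Y\rangle=X_1Y_1-X_2Y_2$; the billiard reflection of $v$ on a non-light-like line $p$ is $u-w$, where $v=u+w$, $u$ is parallel to $p$ and $w$ is Minkowski-orthogonal to $p$. A billiard trajectory within the ellipse is a polygonal line with vertices on the ellipse whose consecutive segments have directions that are reflections of each other on the tangent line at the common vertex; all its segments lie on lines tangent to one confocal conic $\frac{x^2}{a-\gamma}+\frac{y^2}{b+\gamma}=1$, its caustic. It is $3$-periodic if it closes after $3$ reflections. *)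

theory Defs
  imports "HOL-Analysis.Analysis" "HOL-Computational_Algebra.Polynomial"
begin

text \<open>The first argument \<open>\<kappa>\<close> is always the modulus, not the parameter \<open>\<kappa>\<^sup>2\<close>.\<close>

definition elliptic_F :: "real \<Rightarrow> real \<Rightarrow> real" where
  "elliptic_F \<kappa> \<phi> = (LBINT t=0..ereal \<phi>. 1 / sqrt (1 - \<kappa>\<^sup>2 * (sin t)\<^sup>2))"

definition elliptic_K :: "real \<Rightarrow> real" where
  "elliptic_K \<kappa> = elliptic_F \<kappa> (pi / 2)"

definition jacobi_am :: "real \<Rightarrow> real \<Rightarrow> real" where
  "jacobi_am \<kappa> u = (THE \<phi>. elliptic_F \<kappa> \<phi> = u)"

definition jacobi_sn :: "real \<Rightarrow> real \<Rightarrow> real" where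
  "jacobi_sn \<kappa> u = sin (jacobi_am \<kappa> u)"

definition akhiezer_alpha :: "nat \<Rightarrow> nat \<Rightarrow> real \<Rightarrow> real" where
  "akhiezer_alpha n m \<kappa> = 1 - 2 * (jacobi_sn \<kappa> (real m / real n * elliptic_K \<kappa>))\<^sup>2"

definition akhiezer_beta :: "nat \<Rightarrow> nat \<Rightarrow> real \<Rightarrow> real" where
  "akhiezer_beta n m \<kappa> = 2 * (jacobi_sn \<kappa> ((real n - real m) / real n * elliptic_K \<kappa>))\<^sup>2 - 1"

definition akhiezer_set :: "nat \<Rightarrow> nat \<Rightarrow> real \<Rightarrow> real set" where
  "akhiezer_set n m \<kappa> = {-1..akhiezer_alpha n m \<kappa>} \<union> {akhiezer_beta n m \<kappa>..1}"

definition uniform_norm_on :: "real set \<Rightarrow> real poly \<Rightarrow> real" where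
  "uniform_norm_on E p = (SUP x\<in>E. \<bar>poly p x\<bar>)"

definition monic_of_degree :: "nat \<Rightarrow> real poly \<Rightarrow> bool" where
  "monic_of_degree n p \<longleftrightarrow> degree p = n \<and> lead_coeff p = 1"

text \<open>\<open>akhiezer_poly n m \<kappa>\<close> is \<open>TA\<^sub>n(\<cdot>; m, \<kappa>)\<close>, for \<open>0 < m < n\<close> and \<open>0 < \<kappa> < 1\<close>.\<close>

definition akhiezer_poly :: "nat \<Rightarrow> nat \<Rightarrow> real \<Rightarrow> real poly" where
  "akhiezer_poly n m \<kappa> = (THE p. monic_of_degree n p \<and>
     (\<forall>q. monic_of_degree n q \<longrightarrow>
        uniform_norm_on (akhiezer_set n m \<kappa>) p \<le> uniform_norm_on (akhiezer_set n m \<kappa>) q))"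

definition minkowski :: "real \<times> real \<Rightarrow> real \<times> real \<Rightarrow> real" where
  "minkowski X Y = fst X * fst Y - snd X * snd Y"

text \<open>The tangent direction at a point \<open>X\<close> of the conic annihilates the gradient of \<open>x\<^sup>2/A + y\<^sup>2/B\<close> at \<open>X\<close>.\<close>

definition conic :: "real \<Rightarrow> real \<Rightarrow> (real \<times> real) set" where
  "conic A B = {X. (fst X)\<^sup>2 / A + (snd X)\<^sup>2 / B = 1}"

definition tangent_direction :: "real \<Rightarrow> real \<Rightarrow> real \<times> real \<Rightarrow> real \<times> real" where
  "tangent_direction A B X = (- snd X / B, fst X / A)"

definition tangent_line :: "real \<Rightarrow> real \<Rightarrow> real \<times> real \<Rightarrow> (real \<times> real) set" where
  "tangent_line A B X = range (\<lambda>t. X + t *\<^sub>R tangent_direction A B X)"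

text \<open>\<open>v'\<close> is the billiard reflection of \<open>v\<close> on a line with non-light-like direction \<open>p\<close>.\<close>

definition minkowski_reflection ::
    "real \<times> real \<Rightarrow> real \<times> real \<Rightarrow> real \<times> real \<Rightarrow> bool" where
  "minkowski_reflection p v v' \<longleftrightarrow> minkowski p p \<noteq> 0 \<and>
     (\<exists>u w. v = u + w \<and> u \<in> span {p} \<and> minkowski w p = 0 \<and> v' = u - w)"

text \<open>A trajectory is given by its successive vertices \<open>P 0, P 1, \<dots>\<close>. Directions matter only up
  to a positive factor. Trajectories reaching a point where the tangent of the ellipse is
  light-like, so that the reflection is undefined, are excluded.\<close>

definition billiard_trajectory :: "real \<Rightarrow> real \<Rightarrow> (nat \<Rightarrow> real \<times> real) \<Rightarrow> bool" where
  "billiard_trajectory a b P \<longleftrightarrow>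
     (\<forall>k. P k \<in> conic a b \<and> P (Suc k) \<noteq> P k \<and>
        (\<exists>c>0. minkowski_reflection (tangent_direction a b (P (Suc k)))
                 (P (Suc k) - P k) (c *\<^sub>R (P (Suc (Suc k)) - P (Suc k)))))"

definition has_caustic :: "real \<Rightarrow> real \<Rightarrow> real \<Rightarrow> (nat \<Rightarrow> real \<times> real) \<Rightarrow> bool" where
  "has_caustic a b \<gamma> P \<longleftrightarrow>
     (\<forall>k. \<exists>X\<in>conic (a - \<gamma>) (b + \<gamma>).
        affine hull {P k, P (Suc k)} = tangent_line (a - \<gamma>) (b + \<gamma>) X)"

definition closes_after :: "nat \<Rightarrow> (nat \<Rightarrow> real \<times> real) \<Rightarrow> bool" where
  "closes_after n P \<longleftrightarrow> (\<forall>k. P (k + n) = P k)"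

text \<open>The first conjunct rules out that the condition holds because no trajectory has the
  given caustic.\<close>

definition trajectories_periodic :: "nat \<Rightarrow> real \<Rightarrow> real \<Rightarrow> real \<Rightarrow> bool" where
  "trajectories_periodic n a b \<gamma> \<longleftrightarrow>
     (\<exists>P. billiard_trajectory a b P \<and> has_caustic a b \<gamma> P) \<and>
     (\<forall>P. billiard_trajectory a b P \<and> has_caustic a b \<gamma> P \<longrightarrow> closes_after n P)"

definition pell_solution3 :: "real \<Rightarrow> real \<Rightarrow> real \<Rightarrow> real poly \<Rightarrow> bool" where
  "pell_solution3 a b \<gamma> p \<longleftrightarrow> degree p = 3 \<and>
     (\<exists>q. degree q = 1 \<and>
        p\<^sup>2 - [:0, 1:] * [:- (1 / a), 1:] * [:1 / b, 1:] * [:- (1 / \<gamma>), 1:] * q\<^sup>2 = 1)"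

end

theory Submission
  imports Defs
begin

text \<open>A \<open>3\<close>-periodic trajectory is a triangle inscribed in the ellipse and circumscribed about the
  caustic, which forces the Cayley-type quadratic
  \<open>\<gamma>\<^sup>2 (a + b)\<^sup>2 - 2 \<gamma> a b (a - b) - 3 a\<^sup>2 b\<^sup>2 = 0\<close>; it has one positive and one negative root.
  The number \<open>s = sn (K/3)\<close> ranges over \<open>(1/2, 1)\<close> and determines everything rationally:
  \<open>\<kappa>\<^sup>2 = (2 s - 1) / (s\<^sup>3 (2 - s))\<close> and \<open>sn\<^sup>2 (2K/3) = s (2 - s)\<close>, because the duplication formula and the
  reflection \<open>u \<mapsto> K - u\<close> then take \<open>s\<close> to the same value. For \<open>\<gamma> < 0\<close> the condition on the modulus
  becomes \<open>b/a = (1 - s\<^sup>2) / (2 s - 1)\<close>, and \<open>\<gamma> = - a (1 - s\<^sup>2) / s\<^sup>2\<close>. After the affine substitution the Pell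
  equation has the endpoints of the two intervals as branch points; comparing the factors \<open>p - 1\<close> and \<open>p + 1\<close>
  leaves a single cubic up to a factor, and it alternates at four points of the set, so it is the unique
  extremal polynomial. The case \<open>\<gamma> > 0\<close> follows by exchanging \<open>a\<close> and \<open>b\<close> and reversing signs.\<close>

subsection \<open>Trisection of the complete elliptic integral\<close>

lemma elliptic_radicand_pos:
  fixes \<kappa> x :: real
  assumes "\<kappa> \<in> {0<..<1}" "\<bar>x\<bar> \<le> 1"
  shows "0 < 1 - \<kappa>\<^sup>2 * x\<^sup>2"
proof -
  have "\<kappa>\<^sup>2 < 1" using assms(1) by (simp add: power_less_one_iff)
  moreover have "x\<^sup>2 \<le> 1" using assms(2) by (simp add: abs_square_le_1)
  ultimately have "\<kappa>\<^sup>2 * x\<^sup>2 \<le> \<kappa>\<^sup>2 * 1" by (intro mult_left_mono) auto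
  with \<open>\<kappa>\<^sup>2 < 1\<close> show ?thesis by linarith
qed

text \<open>The integrand is continuous because the radicand stays positive, so the fundamental
  theorem of calculus applies.\<close>

lemma has_real_derivative_elliptic_F:
  assumes "\<kappa> \<in> {0<..<1}"
  shows "(elliptic_F \<kappa> has_real_derivative 1 / sqrt (1 - \<kappa>\<^sup>2 * (sin \<phi>)\<^sup>2)) (at \<phi>)"
proof -
  let ?f = "\<lambda>t. 1 / sqrt (1 - \<kappa>\<^sup>2 * (sin t)\<^sup>2)"
  \<comment> \<open>The margin 1 on both sides makes \<phi> an interior point, which turns the
    derivative within the interval into a full derivative.\<close>
  define l u where "l = min 0 \<phi> - 1" and "u = max 0 \<phi> + 1"
  have pos: "0 < 1 - \<kappa>\<^sup>2 * (sin t)\<^sup>2" for t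
    using elliptic_radicand_pos[OF assms, of "sin t"] by simp
  have ne: "sqrt (1 - \<kappa>\<^sup>2 * (sin t)\<^sup>2) \<noteq> 0" for t
    using pos[of t] by simp
  have "continuous_on {l..u} ?f"
    by (intro continuous_intros) (use ne in auto)
  moreover have "l \<le> 0" "0 \<le> u" "l < \<phi>" "\<phi> < u" by (auto simp: l_def u_def)
  ultimately have "((\<lambda>u. LBINT y=ereal 0..ereal u. ?f y) has_vector_derivative ?f \<phi>) (at \<phi> within {l..u})"
    by (intro interval_integral_FTC2) auto
  then have "((\<lambda>u. LBINT y=ereal 0..ereal u. ?f y) has_vector_derivative ?f \<phi>) (at \<phi>)"
    using \<open>l < \<phi>\<close> \<open>\<phi> < u\<close> by (subst (asm) at_within_interior) auto
  moreover have "elliptic_F \<kappa> = (\<lambda>u. LBINT y=ereal 0..ereal u. ?f y)"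
    by (auto simp: elliptic_F_def zero_ereal_def)
  ultimately show ?thesis
    by (simp add: has_real_derivative_iff_has_vector_derivative)
qed

lemma strict_mono_elliptic_F:
  assumes "\<kappa> \<in> {0<..<1}"
  shows "strict_mono (elliptic_F \<kappa>)"
proof (rule strict_monoI)
  fix x y :: real
  assume "x < y"
  show "elliptic_F \<kappa> x < elliptic_F \<kappa> y"
  proof (rule DERIV_pos_imp_increasing[OF \<open>x < y\<close>])
    fix t
    have "0 < 1 - \<kappa>\<^sup>2 * (sin t)\<^sup>2"
      using elliptic_radicand_pos[OF assms, of "sin t"] by simp
    then show "\<exists>d. (elliptic_F \<kappa> has_real_derivative d) (at t) \<and> 0 < d"
      using has_real_derivative_elliptic_F[OF assms, of t]
      by (intro exI[of _ "1 / sqrt (1 - \<kappa>\<^sup>2 * (sin t)\<^sup>2)"]) simp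
  qed
qed

lemma elliptic_F_0 [simp]: "elliptic_F \<kappa> 0 = 0"
  by (simp add: elliptic_F_def zero_ereal_def)

text \<open>Strict monotonicity of \<open>elliptic_F\<close> makes the amplitude unique, so
  exhibiting one preimage evaluates the definite description.\<close>

lemma jacobi_am_eqI:
  assumes "\<kappa> \<in> {0<..<1}" "elliptic_F \<kappa> \<phi> = u"
  shows "jacobi_am \<kappa> u = \<phi>"
  unfolding jacobi_am_def
  using assms strict_mono_elliptic_F[OF assms(1)] by (auto simp: strict_mono_eq)

lemma jacobi_sn_eqI:
  assumes "\<kappa> \<in> {0<..<1}" "\<bar>x\<bar> \<le> 1" "elliptic_F \<kappa> (arcsin x) = u"
  shows "jacobi_sn \<kappa> u = x"
  using jacobi_am_eqI[OF assms(1,3)] assms(2) by (simp add: jacobi_sn_def abs_le_iff)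

lemma has_real_derivative_elliptic_F_arcsin:
  assumes "\<kappa> \<in> {0<..<1}" "\<bar>x\<bar> < 1"
  shows "((\<lambda>x. elliptic_F \<kappa> (arcsin x)) has_real_derivative
           1 / sqrt ((1 - x\<^sup>2) * (1 - \<kappa>\<^sup>2 * x\<^sup>2))) (at x)"
proof -
  have x: "-1 < x" "x < 1" using assms by auto
  show ?thesis
    using DERIV_chain2[OF has_real_derivative_elliptic_F[OF assms(1)] DERIV_arcsin[OF x]] x
    by (simp add: real_sqrt_mult divide_simps mult.commute)
qed

text \<open>The derivative of arcsin blows up at the endpoints; there the constancy arguments below
  rely on continuity alone.\<close>

lemma continuous_on_elliptic_F_arcsin:
  assumes "\<kappa> \<in> {0<..<1}"
  shows "continuous_on {-1..1} (\<lambda>x. elliptic_F \<kappa> (arcsin x))"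
proof -
  have "continuous_on UNIV (elliptic_F \<kappa>)"
    using DERIV_isCont[OF has_real_derivative_elliptic_F[OF assms]]
    by (simp add: continuous_at_imp_continuous_on)
  then show ?thesis
    by (rule continuous_on_compose2[OF _ continuous_on_arcsin']) simp
qed

text \<open>This is \<open>sn (K - u) = cn u / dn u\<close>, read through the inverse function \<open>x \<mapsto> F (arcsin x)\<close> of \<open>sn\<close>;
  the next lemma is \<open>sn (2 u) = 2 sn u cn u dn u / (1 - \<kappa>\<^sup>2 sn\<^sup>4 u)\<close>. Both sides have the same derivative.\<close>

lemma elliptic_F_arcsin_complement:
  assumes k: "\<kappa> \<in> {0<..<1}" and x: "0 < x" "x < 1"
  shows "elliptic_F \<kappa> (arcsin x) + elliptic_F \<kappa> (arcsin (sqrt ((1 - x\<^sup>2) / (1 - \<kappa>\<^sup>2 * x\<^sup>2))))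
           = elliptic_K \<kappa>"
proof -
  define y where "y = (\<lambda>t. sqrt ((1 - t\<^sup>2) / (1 - \<kappa>\<^sup>2 * t\<^sup>2)))"
  define h where "h = (\<lambda>t. elliptic_F \<kappa> (arcsin t) + elliptic_F \<kappa> (arcsin (y t)))"
  have k1: "\<kappa>\<^sup>2 < 1" using k by (simp add: power_less_one_iff)
  have y_le: "y t \<le> 1" and y_ge: "0 \<le> y t" if "0 \<le> t" "t < 1" for t
  proof -
    have "0 < 1 - \<kappa>\<^sup>2 * t\<^sup>2" using elliptic_radicand_pos[OF k, of t] that by simp
    moreover have "t\<^sup>2 \<le> 1" using that by (simp add: abs_square_le_1)
    moreover have "\<kappa>\<^sup>2 * t\<^sup>2 \<le> 1 * t\<^sup>2" using k1 by (intro mult_right_mono) auto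
    ultimately show "y t \<le> 1" "0 \<le> y t" unfolding y_def by auto
  qed
  have cont: "continuous_on {0..x} h"
  proof -
    have ne: "1 - \<kappa>\<^sup>2 * t\<^sup>2 \<noteq> 0" if "t \<in> {0..x}" for t
      using elliptic_radicand_pos[OF k, of t] that x by auto
    have "continuous_on {0..x} y" unfolding y_def
      by (intro continuous_intros) (use ne in auto)
    moreover have "y ` {0..x} \<subseteq> {-1..1}"
    proof clarify
      fix t assume "t \<in> {0..x}"
      then show "y t \<in> {-1..1}" using y_le[of t] y_ge[of t] x by simp
    qed
    ultimately have "continuous_on {0..x} (\<lambda>t. elliptic_F \<kappa> (arcsin (y t)))"
      by (intro continuous_on_compose2[OF continuous_on_elliptic_F_arcsin[OF k]])
    moreover have "continuous_on {0..x} (\<lambda>t. elliptic_F \<kappa> (arcsin t))"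
      by (rule continuous_on_subset[OF continuous_on_elliptic_F_arcsin[OF k]]) (use x in auto)
    ultimately show ?thesis unfolding h_def by (intro continuous_intros)
  qed
  \<comment> \<open>Since \<open>y 0 = 1\<close>, the value \<open>h 0\<close> is
    \<open>elliptic_K \<kappa>\<close>. The derivative is computed only for \<open>0 < t\<close>,
    where \<open>y t < 1\<close>.\<close>
  have "h x = h 0"
  proof (rule DERIV_isconst_end[OF x(1) cont])
    fix t assume t: "0 < t" "t < x"
    define A B where "A = 1 - t\<^sup>2" and "B = 1 - \<kappa>\<^sup>2 * t\<^sup>2"
    define C where "C = 1 - \<kappa>\<^sup>2"
    have C: "0 < C" using k1 by (simp add: C_def)
    have t1: "t < 1" using t x by simp
    have A: "0 < A" using t t1 by (simp add: A_def power_less_one_iff)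
    have B: "0 < B" using elliptic_radicand_pos[OF k, of t] t t1 by (simp add: B_def)
    have BA: "B - A = C * t\<^sup>2" by (simp add: A_def B_def C_def algebra_simps)
    have y2: "(y t)\<^sup>2 = A / B" using A B by (simp add: y_def A_def B_def)
    have ypos: "0 < y t" using A B by (simp add: y_def A_def B_def)
    have yA: "1 - (y t)\<^sup>2 = C * t\<^sup>2 / B"
      using B BA by (simp add: y2 field_simps)
    have yB: "1 - \<kappa>\<^sup>2 * (y t)\<^sup>2 = C / B"
      unfolding y2 using B by (simp add: field_simps) (simp add: A_def B_def C_def algebra_simps)
    have "0 < C * t\<^sup>2 / B" using C B t by simp
    then have "(y t)\<^sup>2 < 1" using yA by linarith
    then have y1: "\<bar>y t\<bar> < 1" by (simp add: abs_square_less_1)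
    have dy: "(y has_real_derivative (- (C * t) / (B\<^sup>2 * y t))) (at t)"
    proof -
      have "((\<lambda>t. (1 - t\<^sup>2) / (1 - \<kappa>\<^sup>2 * t\<^sup>2)) has_real_derivative (- (2 * C * t) / B\<^sup>2)) (at t)"
        using B
        by (auto intro!: derivative_eq_intros simp: B_def)
          (simp add: C_def B_def divide_simps power2_eq_square; simp add: algebra_simps)
      moreover have "0 < (1 - t\<^sup>2) / (1 - \<kappa>\<^sup>2 * t\<^sup>2)" using A B by (simp add: A_def B_def)
      ultimately have "((\<lambda>t. sqrt ((1 - t\<^sup>2) / (1 - \<kappa>\<^sup>2 * t\<^sup>2))) has_real_derivative
          inverse (y t) / 2 * (- (2 * C * t) / B\<^sup>2)) (at t)"
        unfolding y_def by (intro DERIV_chain2[OF DERIV_real_sqrt])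
      then show ?thesis unfolding y_def[symmetric] by (simp add: divide_simps mult.commute)
    qed
    have "((\<lambda>t. elliptic_F \<kappa> (arcsin (y t))) has_real_derivative
        1 / sqrt ((1 - (y t)\<^sup>2) * (1 - \<kappa>\<^sup>2 * (y t)\<^sup>2)) * (- (C * t) / (B\<^sup>2 * y t))) (at t)"
      by (rule DERIV_chain2[OF has_real_derivative_elliptic_F_arcsin[OF k y1] dy])
    moreover have "1 / sqrt ((1 - (y t)\<^sup>2) * (1 - \<kappa>\<^sup>2 * (y t)\<^sup>2)) * (- (C * t) / (B\<^sup>2 * y t))
        = - 1 / sqrt (A * B)"
    proof -
      have "(1 - (y t)\<^sup>2) * (1 - \<kappa>\<^sup>2 * (y t)\<^sup>2) = (C * t / B)\<^sup>2"
        unfolding yA yB by (simp add: power2_eq_square)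
      then have s: "sqrt ((1 - (y t)\<^sup>2) * (1 - \<kappa>\<^sup>2 * (y t)\<^sup>2)) = C * t / B"
        using C t B by simp
      have "y t = sqrt (A * B) / B"
      proof (rule power2_eq_imp_eq)
        show "(y t)\<^sup>2 = (sqrt (A * B) / B)\<^sup>2"
          unfolding y2 using A B by (simp add: power_divide) (simp add: power2_eq_square)
      qed (use ypos A B in auto)
      then show ?thesis unfolding s using A B C t by (simp add: power2_eq_square)
    qed
    moreover have "((\<lambda>t. elliptic_F \<kappa> (arcsin t)) has_real_derivative 1 / sqrt (A * B)) (at t)"
      unfolding A_def B_def using has_real_derivative_elliptic_F_arcsin[OF k, of t] t t1 by simp
    ultimately show "(h has_real_derivative 0) (at t)"
      unfolding h_def by (auto intro!: derivative_eq_intros)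
  qed
  then show ?thesis by (simp add: h_def y_def elliptic_K_def)
qed

lemma elliptic_F_arcsin_double:
  assumes k: "\<kappa> \<in> {0<..<1}" and x: "0 < x" "x < 1" "0 < 1 - 2 * x\<^sup>2 + \<kappa>\<^sup>2 * x ^ 4"
  shows "elliptic_F \<kappa> (arcsin (2 * x * sqrt ((1 - x\<^sup>2) * (1 - \<kappa>\<^sup>2 * x\<^sup>2)) / (1 - \<kappa>\<^sup>2 * x ^ 4)))
           = 2 * elliptic_F \<kappa> (arcsin x)"
proof -
  define R where "R = (\<lambda>t::real. (1 - t\<^sup>2) * (1 - \<kappa>\<^sup>2 * t\<^sup>2))"
  define D where "D = (\<lambda>t::real. 1 - \<kappa>\<^sup>2 * t ^ 4)"
  define y where "y = (\<lambda>t. 2 * t * sqrt (R t) / D t)"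
  \<comment> \<open>In terms of \<open>t = sn u\<close>, the quotients \<open>P t / D t\<close> and
    \<open>Q t / D t\<close> are the duplication formulas for cn and dn. Positivity of
    \<open>P\<close> keeps \<open>y\<close> strictly below 1, where arcsin is
    differentiable.\<close>
  define P where "P = (\<lambda>t. 1 - 2 * t\<^sup>2 + \<kappa>\<^sup>2 * t ^ 4)"
  define Q where "Q = (\<lambda>t. 1 - 2 * \<kappa>\<^sup>2 * t\<^sup>2 + \<kappa>\<^sup>2 * t ^ 4)"
  define h where "h = (\<lambda>t. elliptic_F \<kappa> (arcsin (y t)) - 2 * elliptic_F \<kappa> (arcsin t))"
  have k1: "\<kappa>\<^sup>2 < 1" using k by (simp add: power_less_one_iff)
  have R: "0 < R t" if "0 \<le> t" "t < 1" for t
    using elliptic_radicand_pos[OF k, of t] that by (simp add: R_def power_less_one_iff)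
  have D: "0 < D t" if "0 \<le> t" "t < 1" for t
    using elliptic_radicand_pos[OF k, of "t\<^sup>2"] that by (simp add: D_def abs_square_le_1)
  \<comment> \<open>The hypothesis gives positivity at \<open>x\<close> only; it spreads to smaller
    arguments because \<open>P\<close> decreases.\<close>
  have P: "0 < P t" if "0 \<le> t" "t \<le> x" for t
  proof -
    have "t\<^sup>2 \<le> x\<^sup>2" using that by (intro power_mono) auto
    moreover have "x\<^sup>2 < 1" using x by (simp add: power_less_one_iff)
    moreover have "\<kappa>\<^sup>2 * (x\<^sup>2 + t\<^sup>2) \<le> 1 * (x\<^sup>2 + t\<^sup>2)"
      using k1 by (intro mult_right_mono) auto
    ultimately have "0 \<le> (x\<^sup>2 - t\<^sup>2) * (2 - \<kappa>\<^sup>2 * (x\<^sup>2 + t\<^sup>2))"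
      by (intro mult_nonneg_nonneg) auto
    also have "\<dots> = P t - P x"
      by (simp add: P_def algebra_simps power2_eq_square power4_eq_xxxx)
    finally show ?thesis using x(3) by (simp add: P_def)
  qed
  have Q: "0 < Q t" for t
  proof -
    have "Q t = (1 - \<kappa>\<^sup>2) + \<kappa>\<^sup>2 * (1 - t\<^sup>2)\<^sup>2"
      by (simp add: Q_def algebra_simps power2_eq_square power4_eq_xxxx)
    with k1 show ?thesis by (simp add: add_pos_nonneg)
  qed
  have y1: "1 - (y t)\<^sup>2 = (P t / D t)\<^sup>2" and yk: "1 - \<kappa>\<^sup>2 * (y t)\<^sup>2 = (Q t / D t)\<^sup>2"
    if "0 \<le> t" "t \<le> x" for t
  proof -
    have y2: "(y t)\<^sup>2 = 4 * t\<^sup>2 * R t / (D t)\<^sup>2"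
      using R[of t] that x by (simp add: y_def power_divide power_mult_distrib)
    have D0: "D t \<noteq> 0" using D[of t] that x by auto
    have 1: "(D t)\<^sup>2 - 4 * t\<^sup>2 * R t = (P t)\<^sup>2"
      unfolding D_def P_def R_def by algebra
    have 2: "(D t)\<^sup>2 - \<kappa>\<^sup>2 * (4 * t\<^sup>2 * R t) = (Q t)\<^sup>2"
      unfolding D_def Q_def R_def by algebra
    show "1 - (y t)\<^sup>2 = (P t / D t)\<^sup>2"
      unfolding y2 power_divide 1[symmetric] using D0 by (simp add: diff_divide_distrib)
    show "1 - \<kappa>\<^sup>2 * (y t)\<^sup>2 = (Q t / D t)\<^sup>2"
      unfolding y2 power_divide 2[symmetric] using D0 by (simp add: diff_divide_distrib)
  qed
  have y_less: "\<bar>y t\<bar> < 1" if "0 \<le> t" "t \<le> x" for t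
  proof -
    have "0 < P t / D t" using P[of t] D[of t] that x by simp
    then have "0 < (P t / D t)\<^sup>2" by (rule zero_less_power)
    then have "(y t)\<^sup>2 < 1" using y1[OF that] by linarith
    then show ?thesis by (simp add: abs_square_less_1)
  qed
  have cont: "continuous_on {0..x} h"
  proof -
    have D0: "D t \<noteq> 0" if "t \<in> {0..x}" for t
      using D[of t] that x by auto
    have "continuous_on {0..x} y"
      unfolding y_def using D0 unfolding D_def R_def by (intro continuous_intros) auto
    moreover have "y ` {0..x} \<subseteq> {-1..1}"
    proof clarify
      fix t assume "t \<in> {0..x}"
      then show "y t \<in> {-1..1}" using y_less[of t] by auto
    qed
    ultimately have "continuous_on {0..x} (\<lambda>t. elliptic_F \<kappa> (arcsin (y t)))"
      by (intro continuous_on_compose2[OF continuous_on_elliptic_F_arcsin[OF k]])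
    moreover have "continuous_on {0..x} (\<lambda>t. elliptic_F \<kappa> (arcsin t))"
      by (rule continuous_on_subset[OF continuous_on_elliptic_F_arcsin[OF k]]) (use x in auto)
    ultimately show ?thesis unfolding h_def by (intro continuous_intros)
  qed
  have "h x = h 0"
  proof (rule DERIV_isconst_end[OF x(1) cont])
    fix t assume t: "0 < t" "t < x"
    have Rt: "0 < R t" and Dt: "0 < D t" and Pt: "0 < P t"
      using R[of t] D[of t] P[of t] t x by auto
    define S where "S = sqrt (R t)"
    have S: "0 < S" "S\<^sup>2 = R t" using Rt by (auto simp: S_def)
    define R' where "R' = - 2 * t * (1 - \<kappa>\<^sup>2 * t\<^sup>2) - (1 - t\<^sup>2) * (2 * \<kappa>\<^sup>2 * t)"
    have "(R has_real_derivative R') (at t)"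
      unfolding R_def R'_def by (auto intro!: derivative_eq_intros)
    then have dS: "((\<lambda>t. sqrt (R t)) has_real_derivative inverse S / 2 * R') (at t)"
      unfolding S_def using Rt by (intro DERIV_chain2[OF DERIV_real_sqrt])
    have dD: "(D has_real_derivative - 4 * \<kappa>\<^sup>2 * t ^ 3) (at t)"
      unfolding D_def by (auto intro!: derivative_eq_intros)
    have dy: "(y has_real_derivative 2 * P t * Q t / (S * (D t)\<^sup>2)) (at t)"
    proof -
      have "((\<lambda>t. 2 * t * sqrt (R t)) has_real_derivative 2 * S + 2 * t * (inverse S / 2 * R')) (at t)"
        using DERIV_mult[OF DERIV_cmult[OF DERIV_ident, of 2] dS] by (simp add: S_def algebra_simps)
      from DERIV_divide[OF this dD] have "(y has_real_derivative
          ((2 * S + 2 * t * (inverse S / 2 * R')) * D t - 2 * t * S * (- 4 * \<kappa>\<^sup>2 * t ^ 3)) / (D t * D t)) (at t)"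
        unfolding y_def S_def using Dt by simp
      moreover have "((2 * S + 2 * t * (inverse S / 2 * R')) * D t - 2 * t * S * (- 4 * \<kappa>\<^sup>2 * t ^ 3)) / (D t * D t)
          = ((2 * S\<^sup>2 + t * R') * D t + 8 * \<kappa>\<^sup>2 * t ^ 4 * S\<^sup>2) / (S * (D t)\<^sup>2)"
        using S(1) Dt by (simp add: divide_simps power2_eq_square)
          (simp add: algebra_simps power2_eq_square eval_nat_numeral)
      \<comment> \<open>The numerator of the derivative of \<open>y\<close> is this product, so
        \<open>P t * Q t\<close> cancels against the square root of
        \<open>(1 - y\<^sup>2) (1 - \<kappa>\<^sup>2 y\<^sup>2)\<close>.\<close>
      moreover have "(2 * R t + t * R') * D t + 8 * \<kappa>\<^sup>2 * t ^ 4 * R t = 2 * P t * Q t"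
        unfolding R_def R'_def D_def P_def Q_def by algebra
      ultimately show ?thesis unfolding S(2) by simp
    qed
    have "((\<lambda>t. elliptic_F \<kappa> (arcsin (y t))) has_real_derivative
        1 / sqrt ((1 - (y t)\<^sup>2) * (1 - \<kappa>\<^sup>2 * (y t)\<^sup>2)) * (2 * P t * Q t / (S * (D t)\<^sup>2))) (at t)"
      using y_less[of t] t
      by (intro DERIV_chain2[OF has_real_derivative_elliptic_F_arcsin[OF k] dy]) auto
    moreover have "sqrt ((1 - (y t)\<^sup>2) * (1 - \<kappa>\<^sup>2 * (y t)\<^sup>2)) = P t * Q t / (D t)\<^sup>2"
    proof -
      have "sqrt ((1 - (y t)\<^sup>2) * (1 - \<kappa>\<^sup>2 * (y t)\<^sup>2)) = sqrt ((P t / D t)\<^sup>2 * (Q t / D t)\<^sup>2)"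
        using y1[of t] yk[of t] t by simp
      also have "\<dots> = P t / D t * (Q t / D t)"
        unfolding real_sqrt_mult real_sqrt_abs using Pt Q[of t] Dt by simp
      finally show ?thesis by (simp add: power2_eq_square)
    qed
    moreover have "1 / (P t * Q t / (D t)\<^sup>2) * (2 * P t * Q t / (S * (D t)\<^sup>2)) = 2 * (1 / S)"
      using Pt Q[of t] Dt S(1) by simp
    ultimately have "((\<lambda>t. elliptic_F \<kappa> (arcsin (y t))) has_real_derivative 2 * (1 / S)) (at t)"
      by simp
    moreover have "((\<lambda>t. elliptic_F \<kappa> (arcsin t)) has_real_derivative 1 / S) (at t)"
      unfolding S_def R_def using has_real_derivative_elliptic_F_arcsin[OF k, of t] t x by simp
    ultimately show "(h has_real_derivative 0) (at t)"
      unfolding h_def by (auto intro!: derivative_eq_intros)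
  qed
  then show ?thesis by (simp add: h_def y_def R_def D_def)
qed

text \<open>Under the relation between \<open>\<kappa>\<close> and \<open>s\<close>, the complement
  formula and the duplication formula both send \<open>s\<close> to
  \<open>r = sqrt (s (2 - s))\<close>. Hence the integral up to \<open>arcsin r\<close> is both K
  minus and twice the integral up to \<open>arcsin s\<close>, which must be K/3.\<close>

lemma jacobi_sn_third:
  assumes k: "\<kappa> \<in> {0<..<1}" and s: "s \<in> {1/2<..<1}" and ks: "\<kappa>\<^sup>2 * (s ^ 3 * (2 - s)) = 2 * s - 1"
  shows "jacobi_sn \<kappa> (elliptic_K \<kappa> / 3) = s"
    and "(jacobi_sn \<kappa> (2 * elliptic_K \<kappa> / 3))\<^sup>2 = s * (2 - s)"
proof -
  have s': "1/2 < s" "s < 1" "0 < s" using s by auto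
  define r where "r = sqrt (s * (2 - s))"
  have r2: "r\<^sup>2 = s * (2 - s)" and r: "0 < r" using s' by (auto simp: r_def)
  have k2: "\<kappa>\<^sup>2 = (2 * s - 1) / (s ^ 3 * (2 - s))" using ks s' by (simp add: field_simps)
  have 1: "1 - \<kappa>\<^sup>2 * s\<^sup>2 = (1 - s\<^sup>2) / r\<^sup>2"
    unfolding k2 r2 using s' by (simp add: field_simps eval_nat_numeral)
  have 2: "1 - \<kappa>\<^sup>2 * s ^ 4 = 2 * (1 - s\<^sup>2) / (2 - s)"
    unfolding k2 using s' by (simp add: field_simps eval_nat_numeral)
  have 3: "1 - 2 * s\<^sup>2 + \<kappa>\<^sup>2 * s ^ 4 = 2 * (1 - s)\<^sup>2 * (1 + s) / (2 - s)"
    unfolding k2 using s' by (simp add: field_simps eval_nat_numeral)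
  have s2: "0 < 1 - s\<^sup>2" using s' by (simp add: power_less_one_iff)
  have "r\<^sup>2 < 1"
  proof -
    have "0 < (1 - s)\<^sup>2" using s' by simp
    then show ?thesis unfolding r2 by (simp add: power2_eq_square algebra_simps)
  qed
  then have r1: "r < 1" using r by (simp add: power_less_one_iff)
  have "sqrt ((1 - s\<^sup>2) / (1 - \<kappa>\<^sup>2 * s\<^sup>2)) = r"
    unfolding 1 using s2 r by simp
  then have c: "elliptic_F \<kappa> (arcsin s) + elliptic_F \<kappa> (arcsin r) = elliptic_K \<kappa>"
    using elliptic_F_arcsin_complement[OF k s'(3,2)] by simp
  have "sqrt ((1 - s\<^sup>2) * (1 - \<kappa>\<^sup>2 * s\<^sup>2)) = (1 - s\<^sup>2) / r"
    unfolding 1 using s2 r by (simp add: real_sqrt_divide)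
  then have "2 * s * sqrt ((1 - s\<^sup>2) * (1 - \<kappa>\<^sup>2 * s\<^sup>2)) / (1 - \<kappa>\<^sup>2 * s ^ 4) = r\<^sup>2 / r"
    unfolding 2 r2 using s2 r s' by (simp add: divide_simps)
  moreover have "0 < 1 - 2 * s\<^sup>2 + \<kappa>\<^sup>2 * s ^ 4" unfolding 3 using s' by simp
  ultimately have d: "elliptic_F \<kappa> (arcsin r) = 2 * elliptic_F \<kappa> (arcsin s)"
    using elliptic_F_arcsin_double[OF k s'(3,2)] r by (simp add: power2_eq_square)
  have F: "elliptic_F \<kappa> (arcsin s) = elliptic_K \<kappa> / 3" "elliptic_F \<kappa> (arcsin r) = 2 * elliptic_K \<kappa> / 3"
    using c d by auto
  show "jacobi_sn \<kappa> (elliptic_K \<kappa> / 3) = s"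
    by (rule jacobi_sn_eqI[OF k _ F(1)]) (use s' in auto)
  have "jacobi_sn \<kappa> (2 * elliptic_K \<kappa> / 3) = r"
    by (rule jacobi_sn_eqI[OF k _ F(2)]) (use r r1 in auto)
  then show "(jacobi_sn \<kappa> (2 * elliptic_K \<kappa> / 3))\<^sup>2 = s * (2 - s)" using r2 by simp
qed

lemma jacobi_sn_thirdE:
  assumes k: "\<kappa> \<in> {0<..<1}"
  obtains s where "s \<in> {1/2<..<1}" "\<kappa>\<^sup>2 * (s ^ 3 * (2 - s)) = 2 * s - 1"
    "jacobi_sn \<kappa> (elliptic_K \<kappa> / 3) = s" "(jacobi_sn \<kappa> (2 * elliptic_K \<kappa> / 3))\<^sup>2 = s * (2 - s)"
proof -
  \<comment> \<open>The values are \<open>3/16 \<kappa>\<^sup>2 > 0\<close> at 1/2 and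
    \<open>\<kappa>\<^sup>2 - 1 < 0\<close> at 1, so a zero lies strictly between.\<close>
  define g where "g = (\<lambda>s::real. \<kappa>\<^sup>2 * (s ^ 3 * (2 - s)) - (2 * s - 1))"
  have k2: "0 < \<kappa>\<^sup>2" "\<kappa>\<^sup>2 < 1" using k by (auto simp: power_less_one_iff)
  have "continuous_on {1/2..1} g" unfolding g_def by (intro continuous_intros)
  moreover have g: "0 < g (1/2)" "g 1 < 0" using k2 by (auto simp: g_def)
  ultimately obtain s where s: "1/2 \<le> s" "s \<le> 1" "g s = 0"
    using IVT2'[of g 1 0 "1/2"] by auto
  have "g (1/2) \<noteq> 0" "g 1 \<noteq> 0" using g by auto
  with s(3) have "s \<noteq> 1/2" "s \<noteq> 1" by blast+
  with s have "s \<in> {1/2<..<1}" "\<kappa>\<^sup>2 * (s ^ 3 * (2 - s)) = 2 * s - 1" by (auto simp: g_def)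
  with jacobi_sn_third[OF k this] that show ?thesis by blast
qed

lemma ex_modulus:
  fixes s :: real
  assumes s: "s \<in> {1/2<..<1}"
  obtains \<kappa> where "\<kappa> \<in> {0<..<1}" "\<kappa>\<^sup>2 * (s ^ 3 * (2 - s)) = 2 * s - 1"
proof -
  define c where "c = s ^ 3 * (2 - s)"
  have c: "0 < c" using s by (simp add: c_def)
  \<comment> \<open>This factorization is what puts the squared modulus below 1.\<close>
  have "c - (2 * s - 1) = (1 - s) ^ 3 * (1 + s)" unfolding c_def by algebra
  also have "\<dots> > 0" using s by simp
  finally have "2 * s - 1 < c" by simp
  then have q: "0 < (2 * s - 1) / c" "(2 * s - 1) / c < 1" using s c by auto
  show ?thesis
  proof
    show "sqrt ((2 * s - 1) / c) \<in> {0<..<1}" using q by simp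
    show "(sqrt ((2 * s - 1) / c))\<^sup>2 * (s ^ 3 * (2 - s)) = 2 * s - 1"
      unfolding c_def[symmetric] using q c by simp
  qed
qed

subsection \<open>Triangles inscribed in the ellipse and circumscribed about the caustic\<close>

text \<open>Tangency becomes an equation of the dual conic: the tangent at \<open>X\<close> is the
  polar line of \<open>X\<close>, with coefficients \<open>fst X / A\<close> and
  \<open>snd X / B\<close>.\<close>

lemma tangent_chord_coefficients:
  assumes "A \<noteq> 0" "B \<noteq> 0" "X \<in> conic A B" "affine hull {P, Q} = tangent_line A B X"
  obtains l m where "l * fst P + m * snd P = 1" "l * fst Q + m * snd Q = 1" "A * l\<^sup>2 + B * m\<^sup>2 = 1"
proof -
  define l m where "l = fst X / A" and "m = snd X / B"
  have X: "(fst X)\<^sup>2 / A + (snd X)\<^sup>2 / B = 1" using assms(3) by (simp add: conic_def)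
  have line: "l * fst R + m * snd R = 1" if "R \<in> tangent_line A B X" for R
  proof -
    from that obtain t where R: "R = X + t *\<^sub>R tangent_direction A B X"
      by (auto simp: tangent_line_def)
    have "l * fst R + m * snd R = (fst X)\<^sup>2 / A + (snd X)\<^sup>2 / B"
      by (simp add: R tangent_direction_def l_def m_def algebra_simps power2_eq_square)
    with X show ?thesis by simp
  qed
  have "P \<in> affine hull {P, Q}" "Q \<in> affine hull {P, Q}" by (auto simp: hull_inc)
  then have "l * fst P + m * snd P = 1" "l * fst Q + m * snd Q = 1"
    unfolding assms(4) by (auto intro: line)
  moreover have "A * l\<^sup>2 + B * m\<^sup>2 = 1"
    using X assms(1,2) by (simp add: l_def m_def power_divide power2_eq_square)
  ultimately show ?thesis by (rule that)
qed

text \<open>Cramer's rule expresses \<open>l\<close> and \<open>m\<close> by the two points;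
  inserting them into the dual conic leaves a relation between the points alone.\<close>

lemma unit_circle_tangent_chord:
  fixes c s c' s' u v l m :: real
  assumes "c\<^sup>2 + s\<^sup>2 = 1" "c'\<^sup>2 + s'\<^sup>2 = 1" "(c, s) \<noteq> (c', s')"
    and "l * c + m * s = 1" "l * c' + m * s' = 1" "u * l\<^sup>2 + v * m\<^sup>2 = 1"
  shows "(u + v - 1) - (c * c' + s * s') + (u - v) * (c * c' - s * s') = 0"
proof -
  define D where "D = c * s' - c' * s"
  have l: "l * D = s' - s" and m: "m * D = c - c'"
    unfolding D_def using assms(4,5) by algebra+
  have "u * (s' - s)\<^sup>2 + v * (c - c')\<^sup>2 = (u * l\<^sup>2 + v * m\<^sup>2) * D\<^sup>2"
    unfolding l[symmetric] m[symmetric] by algebra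
  then have "u * (s' - s)\<^sup>2 + v * (c - c')\<^sup>2 = D\<^sup>2" using assms(6) by simp
  \<comment> \<open>In angles, \<open>c * c' + s * s'\<close> is the cosine of the difference and
    \<open>c * c' - s * s'\<close> that of the sum. All three squares share the factor one minus the
    cosine of the difference, which is nonzero for distinct points.\<close>
  moreover have "(s' - s)\<^sup>2 = (1 - (c * c' + s * s')) * (1 + (c * c' - s * s'))"
    "(c - c')\<^sup>2 = (1 - (c * c' + s * s')) * (1 - (c * c' - s * s'))"
    "D\<^sup>2 = (1 - (c * c' + s * s')) * (1 + (c * c' + s * s'))"
    unfolding D_def using assms(1,2) by algebra+
  ultimately have "(1 - (c * c' + s * s')) *
      ((u + v - 1) - (c * c' + s * s') + (u - v) * (c * c' - s * s')) = 0"
    by (simp add: algebra_simps)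
  moreover have "1 - (c * c' + s * s') \<noteq> 0"
  proof
    assume "1 - (c * c' + s * s') = 0"
    then have "(c - c')\<^sup>2 + (s - s')\<^sup>2 = 0" using assms(1,2) by algebra
    then show False using assms(3) by (simp add: sum_power2_eq_zero_iff)
  qed
  ultimately show ?thesis by simp
qed

text \<open>On the unit circle the relation of the previous lemma, with \<open>A = u + v - 1\<close> and \<open>k = u - v\<close>, is a symmetric
  \<open>(2,2)\<close>-correspondence; three points pairwise related by it form a Poncelet triangle.\<close>

lemma triangle_correspondence:
  fixes z1 z2 z3 :: complex and A k :: real
  assumes unit: "z1 * cnj z1 = 1" "z2 * cnj z2 = 1" "z3 * cnj z3 = 1"
    and dist: "z1 \<noteq> z2" "z1 \<noteq> z3" "z2 \<noteq> z3"
    and corr: "2 * of_real A * z1 * z2 - (z1\<^sup>2 + z2\<^sup>2) + of_real k * (z1\<^sup>2 * z2\<^sup>2 + 1) = 0"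
      "2 * of_real A * z1 * z3 - (z1\<^sup>2 + z3\<^sup>2) + of_real k * (z1\<^sup>2 * z3\<^sup>2 + 1) = 0"
      "2 * of_real A * z2 * z3 - (z2\<^sup>2 + z3\<^sup>2) + of_real k * (z2\<^sup>2 * z3\<^sup>2 + 1) = 0"
  shows "k\<^sup>2 = 1 + 2 * A"
proof -
  define K B where "K = complex_of_real k" and "B = complex_of_real A"
  define e1 e2 e3 where "e1 = z1 + z2 + z3" and "e2 = z1 * z2 + z1 * z3 + z2 * z3"
    and "e3 = z1 * z2 * z3"
  note corr = corr[folded K_def B_def]
  \<comment> \<open>Two relations with the common point \<open>z1\<close> are subtracted and the
    difference of the other two points is cancelled.\<close>
  have "(z2 - z3) * (2 * B * z1 + (K * z1\<^sup>2 - 1) * (z2 + z3)) = 0" using corr(1,2) by algebra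
  then have 1: "2 * B * z1 + (K * z1\<^sup>2 - 1) * (z2 + z3) = 0" using dist by simp
  have "(z1 - z3) * (2 * B * z2 + (K * z2\<^sup>2 - 1) * (z1 + z3)) = 0" using corr(1,3) by algebra
  then have 2: "2 * B * z2 + (K * z2\<^sup>2 - 1) * (z1 + z3) = 0" using dist by simp
  \<comment> \<open>The cubics \<open>K z\<^sup>3 - K e1 z\<^sup>2 - (1 + 2 B) z + e1\<close> and \<open>K (z - z1) (z - z2) (z - z3)\<close> agree at
    the \<open>z i\<close> and in the two leading coefficients, hence everywhere.\<close>
  have lin: "(1 + 2 * B + K * e2) * z1 = e1 + K * e3" "(1 + 2 * B + K * e2) * z2 = e1 + K * e3"
    unfolding e1_def e2_def e3_def using 1 2 by algebra+
  then have "(1 + 2 * B + K * e2) * (z1 - z2) = 0" by (simp add: algebra_simps)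
  then have B: "1 + 2 * B + K * e2 = 0" using dist by simp
  with lin(1) have "e1 + K * e3 = 0" by simp
  \<comment> \<open>Since \<open>K\<close> is real, conjugation gives a second relation. On the unit
    circle conjugates are inverses, so multiplying by \<open>e3\<close> turns \<open>cnj e1\<close>
    into \<open>e2\<close>.\<close>
  then have "cnj e1 + K * cnj e3 = 0"
    by (metis K_def complex_cnj_add complex_cnj_complex_of_real complex_cnj_mult complex_cnj_zero)
  moreover have "e3 * cnj e1 = e2" "e3 * cnj e3 = 1"
    unfolding e1_def e2_def e3_def complex_cnj_add complex_cnj_mult using unit by algebra+
  ultimately have "e2 + K = 0" by algebra
  with B have "K\<^sup>2 = 1 + 2 * B" by algebra
  then have "complex_of_real (k\<^sup>2) = complex_of_real (1 + 2 * A)" by (simp add: K_def B_def)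
  then show ?thesis by (simp only: of_real_eq_iff)
qed

text \<open>Rescaling the axes turns the ellipse into the unit circle, and the sides of one closed
  trajectory give the three relations of \<open>triangle_correspondence\<close>. Its conclusion is
  the quadratic after clearing denominators.\<close>

lemma periodic_caustic_quadratic:
  fixes a b \<gamma> :: real
  assumes "a > 0" "b > 0" "\<gamma> \<notin> {-b, 0, a}" "trajectories_periodic 3 a b \<gamma>"
  shows "\<gamma>\<^sup>2 * (a + b)\<^sup>2 - 2 * \<gamma> * a * b * (a - b) - 3 * a\<^sup>2 * b\<^sup>2 = 0"
proof -
  from assms(4) obtain P where P: "billiard_trajectory a b P" "has_caustic a b \<gamma> P" "closes_after 3 P"
    unfolding trajectories_periodic_def by blast
  have on: "P k \<in> conic a b" and step: "P (Suc k) \<noteq> P k" for k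
    using P(1) unfolding billiard_trajectory_def by auto
  have P3: "P 3 = P 0" using P(3) unfolding closes_after_def by (metis add_0)
  have ne: "P 0 \<noteq> P 1" "P 1 \<noteq> P 2" "P 2 \<noteq> P 3"
    using step[of 0] step[of 1] step[of 2] by (auto simp: numeral_eq_Suc)
  have nz: "a - \<gamma> \<noteq> 0" "b + \<gamma> \<noteq> 0" using assms(3) by (auto simp: add_eq_0_iff)
  \<comment> \<open>These are \<open>u + v - 1\<close> and \<open>u - v\<close> for the rescaled
    caustic with \<open>u = 1 - \<gamma> / a\<close> and
    \<open>v = 1 + \<gamma> / b\<close>.\<close>
  define A k where "A = 1 - \<gamma> / a + \<gamma> / b" and "k = - (\<gamma> / a) - \<gamma> / b"
  define z where "z = (\<lambda>i. Complex (fst (P i) / sqrt a) (snd (P i) / sqrt b))"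
  have circle: "(fst (P i) / sqrt a)\<^sup>2 + (snd (P i) / sqrt b)\<^sup>2 = 1" for i
    using on[of i] assms(1,2) by (simp add: conic_def power_divide)
  have unit: "z i * cnj (z i) = 1" for i
    using circle[of i] by (simp add: complex_eq_iff z_def power2_eq_square)
  have z_inj: "z i \<noteq> z j" if "P i \<noteq> P j" for i j
    using that assms(1,2) by (auto simp: z_def prod_eq_iff)
  have corr: "2 * of_real A * z i * z (Suc i) - ((z i)\<^sup>2 + (z (Suc i))\<^sup>2)
      + of_real k * ((z i)\<^sup>2 * (z (Suc i))\<^sup>2 + 1) = 0" for i
  proof -
    obtain X where "X \<in> conic (a - \<gamma>) (b + \<gamma>)"
      "affine hull {P i, P (Suc i)} = tangent_line (a - \<gamma>) (b + \<gamma>) X"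
      using P(2) unfolding has_caustic_def by blast
    then obtain l m where lm: "l * fst (P i) + m * snd (P i) = 1"
        "l * fst (P (Suc i)) + m * snd (P (Suc i)) = 1" "(a - \<gamma>) * l\<^sup>2 + (b + \<gamma>) * m\<^sup>2 = 1"
      by (rule tangent_chord_coefficients[OF nz])
    have "(1 - \<gamma> / a) * (l * sqrt a)\<^sup>2 + (1 + \<gamma> / b) * (m * sqrt b)\<^sup>2 = 1"
    proof -
      have "(1 - \<gamma> / a) * (l * sqrt a)\<^sup>2 = (a - \<gamma>) * l\<^sup>2"
        "(1 + \<gamma> / b) * (m * sqrt b)\<^sup>2 = (b + \<gamma>) * m\<^sup>2"
        using assms(1,2) by (simp_all add: power_mult_distrib field_simps)
      with lm(3) show ?thesis by simp
    qed
    moreover have "(fst (P i) / sqrt a, snd (P i) / sqrt b)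
        \<noteq> (fst (P (Suc i)) / sqrt a, snd (P (Suc i)) / sqrt b)"
      using step[of i] assms(1,2) by (auto simp: prod_eq_iff)
    ultimately have "((1 - \<gamma> / a) + (1 + \<gamma> / b) - 1)
        - (fst (P i) / sqrt a * (fst (P (Suc i)) / sqrt a) + snd (P i) / sqrt b * (snd (P (Suc i)) / sqrt b))
        + ((1 - \<gamma> / a) - (1 + \<gamma> / b))
          * (fst (P i) / sqrt a * (fst (P (Suc i)) / sqrt a) - snd (P i) / sqrt b * (snd (P (Suc i)) / sqrt b)) = 0"
      using lm assms(1,2)
      by (intro unit_circle_tangent_chord[OF circle circle, of _ _ "l * sqrt a" "m * sqrt b"]) auto
    then have "A - Re (z i * cnj (z (Suc i))) + k * Re (z i * z (Suc i)) = 0"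
      by (simp add: A_def k_def z_def)
    then have "complex_of_real (2 * (A - Re (z i * cnj (z (Suc i))) + k * Re (z i * z (Suc i)))) = 0"
      by simp
    moreover have "complex_of_real (2 * Re (z i * cnj (z (Suc i)))) = z i * cnj (z (Suc i)) + cnj (z i) * z (Suc i)"
      "complex_of_real (2 * Re (z i * z (Suc i))) = z i * z (Suc i) + cnj (z i) * cnj (z (Suc i))"
      by (simp_all add: complex_eq_iff)
    ultimately have "2 * of_real A - (z i * cnj (z (Suc i)) + cnj (z i) * z (Suc i))
        + of_real k * (z i * z (Suc i) + cnj (z i) * cnj (z (Suc i))) = 0"
      by (simp add: algebra_simps)
    \<comment> \<open>Multiplication by \<open>z i * z (Suc i)\<close> removes the
      conjugates.\<close>
    then show ?thesis using unit[of i] unit[of "Suc i"] by algebra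
  qed
  have "k\<^sup>2 = 1 + 2 * A"
  proof (rule triangle_correspondence)
    show "2 * of_real A * z 0 * z 1 - ((z 0)\<^sup>2 + (z 1)\<^sup>2) + of_real k * ((z 0)\<^sup>2 * (z 1)\<^sup>2 + 1) = 0"
      using corr[of 0] by simp
    show "2 * of_real A * z 1 * z 2 - ((z 1)\<^sup>2 + (z 2)\<^sup>2) + of_real k * ((z 1)\<^sup>2 * (z 2)\<^sup>2 + 1) = 0"
      using corr[of 1] by (simp add: numeral_2_eq_2)
    have "z 3 = z 0" using P3 by (simp add: z_def)
    moreover have "Suc 2 = 3" by simp
    ultimately show "2 * of_real A * z 0 * z 2 - ((z 0)\<^sup>2 + (z 2)\<^sup>2) + of_real k * ((z 0)\<^sup>2 * (z 2)\<^sup>2 + 1) = 0"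
      using corr[of 2] by (simp only: ac_simps)
    have "P 0 \<noteq> P 2" using ne(3) P3 by simp
    then show "z 0 \<noteq> z 1" "z 0 \<noteq> z 2" "z 1 \<noteq> z 2" using ne z_inj by blast+
  qed (rule unit)+
  then have "(k * (a * b))\<^sup>2 = (1 + 2 * A) * (a * b)\<^sup>2" by (simp add: power_mult_distrib)
  moreover have "k * (a * b) = - \<gamma> * (a + b)" "A * (a * b) = a * b - \<gamma> * b + \<gamma> * a"
    using assms(1,2) by (simp_all add: A_def k_def field_simps)
  ultimately show ?thesis by algebra
qed

text \<open>The quadratic has one root \<open>g\<close> in \<open>(0, a)\<close> and one negative
  root \<open>h\<close>, so lying in the interval singles out \<open>g\<close>. The lemma is also
  applied with \<open>a\<close> and \<open>b\<close> exchanged and \<gamma> negated.\<close>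

lemma caustic_quadratic_roots:
  fixes a b \<gamma> :: real
  assumes "a > 0" "b > 0" "\<gamma>\<^sup>2 * (a + b)\<^sup>2 - 2 * \<gamma> * a * b * (a - b) - 3 * a\<^sup>2 * b\<^sup>2 = 0"
  shows "\<gamma> \<in> {0<..<a} \<longleftrightarrow> \<gamma> = a * b / (a + b)\<^sup>2 * (a - b + 2 * sqrt (a\<^sup>2 + a * b + b\<^sup>2))"
proof -
  define w where "w = sqrt (a\<^sup>2 + a * b + b\<^sup>2)"
  have w2: "w\<^sup>2 = a\<^sup>2 + a * b + b\<^sup>2" and w: "0 < w"
    using assms(1,2) by (auto simp: w_def add_pos_pos)
  define g h where "g = a * b / (a + b)\<^sup>2 * (a - b + 2 * w)" and "h = a * b / (a + b)\<^sup>2 * (a - b - 2 * w)"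
  have g': "(a + b)\<^sup>2 * g = a * b * (a - b + 2 * w)" and h': "(a + b)\<^sup>2 * h = a * b * (a - b - 2 * w)"
    using assms(1,2) by (simp_all add: g_def h_def)
  have "((a + b)\<^sup>2 * \<gamma> - (a + b)\<^sup>2 * g) * ((a + b)\<^sup>2 * \<gamma> - (a + b)\<^sup>2 * h) = 0"
    unfolding g' h' using assms(3) w2 by algebra
  then have root: "\<gamma> = g \<or> \<gamma> = h" using assms(1,2) by auto
  have "\<bar>a - b\<bar> < 2 * w"
  proof (rule power2_less_imp_less)
    have "(2 * w)\<^sup>2 - (a - b)\<^sup>2 = 3 * (a + b)\<^sup>2" using w2 by algebra
    moreover have "0 < (a + b)\<^sup>2" using assms(1,2) by simp
    ultimately show "\<bar>a - b\<bar>\<^sup>2 < (2 * w)\<^sup>2" unfolding power2_abs by linarith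
  qed (use w in simp)
  then have pm: "0 < a - b + 2 * w" "a - b - 2 * w < 0" by auto
  have f: "0 < a * b / (a + b)\<^sup>2" using assms(1,2) by simp
  have g0: "0 < g" unfolding g_def using f pm(1) by (rule mult_pos_pos)
  have h0: "h < 0" unfolding h_def using f pm(2) by (rule mult_pos_neg)
  have "2 * b * w < a\<^sup>2 + a * b + 2 * b\<^sup>2"
  proof (rule power2_less_imp_less)
    have "(a\<^sup>2 + a * b + 2 * b\<^sup>2)\<^sup>2 - (2 * b * w)\<^sup>2 = a\<^sup>2 * (a + b)\<^sup>2" using w2 by algebra
    moreover have "0 < a\<^sup>2 * (a + b)\<^sup>2" using assms(1,2) by simp
    ultimately show "(2 * b * w)\<^sup>2 < (a\<^sup>2 + a * b + 2 * b\<^sup>2)\<^sup>2" by linarith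
  qed (use assms(1,2) in simp)
  then have "0 < a * (a\<^sup>2 + a * b + 2 * b\<^sup>2 - 2 * b * w)" using assms(1) by simp
  also have "\<dots> = (a + b)\<^sup>2 * (a - g)" unfolding right_diff_distrib g' by algebra
  finally have "g < a" by (simp add: zero_less_mult_iff)
  with root g0 h0 show ?thesis unfolding w_def[symmetric] g_def[symmetric] by auto
qed

subsection \<open>Alternation and the Pell equation\<close>

lemma poly_sign_alternation_eq_0:
  fixes r :: "real poly" and x0 x1 x2 x3 :: real
  assumes deg: "degree r \<le> 2" and ord: "x0 < x1" "x1 < x2" "x2 < x3"
    and sgn: "poly r x0 \<le> 0" "0 \<le> poly r x1" "poly r x2 \<le> 0" "0 \<le> poly r x3"
  shows "r = 0"
proof -
  define w0 w1 w2 w3 where "w0 = (x2 - x1) * (x3 - x1) * (x3 - x2)"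
    and "w1 = (x2 - x0) * (x3 - x0) * (x3 - x2)" and "w2 = (x1 - x0) * (x3 - x0) * (x3 - x1)"
    and "w3 = (x1 - x0) * (x2 - x0) * (x2 - x1)"
  have w: "0 < w0" "0 < w1" "0 < w2" "0 < w3"
    using ord by (auto simp: w0_def w1_def w2_def w3_def)
  define c where "c = coeff r"
  have r: "poly r x = c 0 + c 1 * x + c 2 * x\<^sup>2" for x
  proof -
    have "r = [:c 0, c 1, c 2:]"
      using deg by (intro poly_eqI) (auto simp: c_def coeff_pCons coeff_eq_0 eval_nat_numeral split: nat.split)
    then have "poly r x = poly [:c 0, c 1, c 2:] x" by simp
    then show ?thesis by (simp add: algebra_simps power2_eq_square)
  qed
  \<comment> \<open>The third divided difference of a quadratic vanishes; here all its terms have the same sign.\<close>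
  have "poly r x3 * w3 - poly r x2 * w2 + poly r x1 * w1 - poly r x0 * w0 = 0"
    unfolding r w0_def w1_def w2_def w3_def by algebra
  moreover have "0 \<le> poly r x3 * w3" "poly r x2 * w2 \<le> 0" "0 \<le> poly r x1 * w1" "poly r x0 * w0 \<le> 0"
    using sgn w by (auto intro: mult_nonpos_nonneg)
  ultimately have "poly r x0 * w0 = 0" "poly r x1 * w1 = 0" "poly r x2 * w2 = 0" by linarith+
  then have roots: "{x0, x1, x2} \<subseteq> {x. poly r x = 0}" using w by simp
  show "r = 0"
  proof (rule ccontr)
    assume "r \<noteq> 0"
    then have "card {x0, x1, x2} \<le> card {x. poly r x = 0}"
      using roots by (intro card_mono poly_roots_finite)
    also have "\<dots> \<le> 2" using card_poly_roots_bound[OF \<open>r \<noteq> 0\<close>] deg by linarith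
    finally show False using ord by simp
  qed
qed

text \<open>If a monic cubic \<open>q\<close> has norm at most \<open>L\<close>, then
  \<open>T - q\<close> has degree at most 2 and weakly alternating signs at the four points, hence
  vanishes. This gives minimality and uniqueness together.\<close>

lemma akhiezer_poly_eqI:
  fixes T :: "real poly" and L x0 x1 x2 x3 :: real
  assumes T: "monic_of_degree 3 T"
    and bound: "\<And>x. x \<in> akhiezer_set 3 m \<kappa> \<Longrightarrow> \<bar>poly T x\<bar> \<le> L"
    and mem: "{x0, x1, x2, x3} \<subseteq> akhiezer_set 3 m \<kappa>" and ord: "x0 < x1" "x1 < x2" "x2 < x3"
    and alt: "poly T x0 = - L" "poly T x1 = L" "poly T x2 = - L" "poly T x3 = L"
  shows "akhiezer_poly 3 m \<kappa> = T"
proof -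
  let ?E = "akhiezer_set 3 m \<kappa>"
  have compact: "compact ?E" unfolding akhiezer_set_def by (intro compact_Un compact_Icc)
  have le: "\<bar>poly q x\<bar> \<le> uniform_norm_on ?E q" if "x \<in> ?E" for q x
  proof -
    have "compact ((\<lambda>x. \<bar>poly q x\<bar>) ` ?E)"
      by (intro compact_continuous_image compact continuous_intros)
    then have "bdd_above ((\<lambda>x. \<bar>poly q x\<bar>) ` ?E)"
      by (intro bounded_imp_bdd_above compact_imp_bounded)
    with that show ?thesis unfolding uniform_norm_on_def by (rule cSUP_upper)
  qed
  have norm_T: "uniform_norm_on ?E T \<le> L"
    unfolding uniform_norm_on_def using mem bound by (intro cSUP_least) auto
  have unique: "q = T" if q: "monic_of_degree 3 q" "uniform_norm_on ?E q \<le> L" for q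
  proof -
    have "degree (T - q) \<le> 2"
    proof (rule degree_le, intro allI impI)
      fix i :: nat assume "2 < i"
      then consider "i = 3" | "3 < i" by linarith
      then show "coeff (T - q) i = 0"
        using T q(1) by cases (auto simp: monic_of_degree_def coeff_eq_0)
    qed
    moreover have "\<bar>poly q x\<bar> \<le> L" if "x \<in> {x0, x1, x2, x3}" for x
      using le[of x q] q(2) mem that by force
    then have "\<bar>poly q x0\<bar> \<le> L" "\<bar>poly q x1\<bar> \<le> L" "\<bar>poly q x2\<bar> \<le> L" "\<bar>poly q x3\<bar> \<le> L"
      by auto
    ultimately have "T - q = 0"
      by (intro poly_sign_alternation_eq_0[OF _ ord]) (auto simp: alt)
    then show ?thesis by simp
  qed
  \<comment> \<open>A norm below \<open>L\<close> would force \<open>q = T\<close>, yet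
    \<open>T\<close> attains \<open>L\<close> at \<open>x3\<close>.\<close>
  have "L \<le> uniform_norm_on ?E q" if "monic_of_degree 3 q" for q
    using unique[OF that] le[of x3 T] mem alt by fastforce
  then have min: "uniform_norm_on ?E T \<le> uniform_norm_on ?E q" if "monic_of_degree 3 q" for q
    using norm_T that by force
  show ?thesis
    unfolding akhiezer_poly_def
  proof (rule the_equality)
    show "monic_of_degree 3 T \<and> (\<forall>q. monic_of_degree 3 q \<longrightarrow> uniform_norm_on ?E T \<le> uniform_norm_on ?E q)"
      using T min by blast
  next
    fix q assume "monic_of_degree 3 q \<and> (\<forall>p. monic_of_degree 3 p \<longrightarrow> uniform_norm_on ?E q \<le> uniform_norm_on ?E p)"
    then show "q = T" using unique[of q] norm_T T by (meson order_trans)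
  qed
qed

text \<open>With \<open>s = sn (K/3)\<close> the extremal polynomial is \<open>(x - 1) (x - \<alpha>) (x - \<beta>) + L\<close>, where
  \<open>\<alpha> = 1 - 4 s + 2 s\<^sup>2\<close> and \<open>\<beta> = 2 s\<^sup>2 - 1\<close>. The norm \<open>L\<close> is such that adding it once more
  gives a double root: \<open>(x + 1) (x - \<rho>)\<^sup>2\<close> with \<open>\<rho> = 1 - 2 s + 2 s\<^sup>2\<close>.\<close>

definition extremal_norm :: "real \<Rightarrow> real" where
  "extremal_norm s = 4 * s\<^sup>2 * (1 - s)\<^sup>2"

definition extremal_cubic :: "real \<Rightarrow> real poly" where
  "extremal_cubic s = [:-1, 1:] * [:- (1 - 4 * s + 2 * s\<^sup>2), 1:] * [:- (2 * s\<^sup>2 - 1), 1:] + [:extremal_norm s:]"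

lemma poly_extremal_cubic:
  "poly (extremal_cubic s) x = (x - 1) * (x - (1 - 4 * s + 2 * s\<^sup>2)) * (x - (2 * s\<^sup>2 - 1)) + extremal_norm s"
  by (simp add: extremal_cubic_def algebra_simps)

lemma poly_extremal_cubic':
  "poly (extremal_cubic s) x = (x + 1) * (x - (1 - 2 * s + 2 * s\<^sup>2))\<^sup>2 - extremal_norm s"
  unfolding poly_extremal_cubic extremal_norm_def by algebra

lemma monic_extremal_cubic: "monic_of_degree 3 (extremal_cubic s)"
  by (simp add: monic_of_degree_def extremal_cubic_def eval_nat_numeral)

text \<open>Each factorization gives one bound: the product of three linear factors is nonpositive
  on the set, and the one with the square is nonnegative there.\<close>

lemma abs_extremal_cubic_le:
  assumes s: "s \<in> {1/2<..<1}" and x: "x \<in> {-1..1 - 4 * s + 2 * s\<^sup>2} \<union> {2 * s\<^sup>2 - 1..1}"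
  shows "\<bar>poly (extremal_cubic s) x\<bar> \<le> extremal_norm s"
proof -
  have order: "1 - 4 * s + 2 * s\<^sup>2 \<le> 2 * s\<^sup>2 - 1" using s by simp
  have "s\<^sup>2 < 1" using s by (simp add: power_less_one_iff)
  with order have "(x - 1) * ((x - (1 - 4 * s + 2 * s\<^sup>2)) * (x - (2 * s\<^sup>2 - 1))) \<le> 0"
    using x s by (intro mult_nonpos_nonneg) (auto intro: mult_nonneg_nonneg mult_nonpos_nonpos)
  moreover have "0 \<le> (x + 1) * (x - (1 - 2 * s + 2 * s\<^sup>2))\<^sup>2"
  proof (intro mult_nonneg_nonneg)
    from x consider "-1 \<le> x" | "2 * s\<^sup>2 - 1 \<le> x" by auto
    then show "0 \<le> x + 1" using zero_le_power2[of s] by cases linarith+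
  qed simp
  ultimately show ?thesis
    using poly_extremal_cubic[of s x] poly_extremal_cubic'[of s x] by (simp add: mult.assoc abs_le_iff)
qed


section \<open>Cubic solutions of the Pell equation\<close>

text \<open>Comparison of coefficients. After shifting by \<open>e\<close>, the cubic
  \<open>(x - r)\<^sup>2 x + 2 L\<close> has elementary symmetric functions \<open>2 r\<close> and
  \<open>r\<^sup>2\<close>; eliminating \<open>r\<close> yields the third claim, which tests whether
  \<open>e\<close> can be the simple root.\<close>

lemma monic_quartic_factor_with_double_root:
  fixes e r L y1 y2 y3 :: real
  assumes "\<And>x. (x - e) * ((x - r)\<^sup>2 * (x - e) + 2 * L) = (x - e) * ((x - y1) * (x - y2) * (x - y3))"
  shows "2 * r + e = y1 + y2 + y3" "2 * L - r\<^sup>2 * e = - (y1 * y2 * y3)"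
    and "(y1 - e)\<^sup>2 + (y2 - e)\<^sup>2 + (y3 - e)\<^sup>2
      = 2 * ((y1 - e) * (y2 - e) + (y1 - e) * (y3 - e) + (y2 - e) * (y3 - e))"
proof -
  define A B C where "A = y1 + y2 + y3 - 2 * r - e"
    and "B = r\<^sup>2 + 2 * r * e - (y1 * y2 + y1 * y3 + y2 * y3)"
    and "C = 2 * L - r\<^sup>2 * e + y1 * y2 * y3"
  have "A * x\<^sup>2 + B * x + C = 0" if "x \<noteq> e" for x
  proof -
    have "(x - r)\<^sup>2 * (x - e) + 2 * L = (x - y1) * (x - y2) * (x - y3)"
      using assms[of x] that by simp
    then show ?thesis unfolding A_def B_def C_def by algebra
  qed
  \<comment> \<open>The factor \<open>x - e\<close> cancels only away from \<open>e\<close>, and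
    three such points suffice to annihilate a quadratic.\<close>
  from this[of "e + 1"] this[of "e + 2"] this[of "e + 3"]
  have "A * (e + 1)\<^sup>2 + B * (e + 1) + C = 0" "A * (e + 2)\<^sup>2 + B * (e + 2) + C = 0"
    "A * (e + 3)\<^sup>2 + B * (e + 3) + C = 0" by simp_all
  then have ABC: "A = 0" "B = 0" "C = 0" by algebra+
  show "2 * r + e = y1 + y2 + y3" "2 * L - r\<^sup>2 * e = - (y1 * y2 * y3)"
    using ABC by (simp_all add: A_def C_def)
  show "(y1 - e)\<^sup>2 + (y2 - e)\<^sup>2 + (y3 - e)\<^sup>2
      = 2 * ((y1 - e) * (y2 - e) + (y1 - e) * (y3 - e) + (y2 - e) * (y3 - e))"
    using ABC(1,2) unfolding A_def B_def by algebra
qed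

lemma pell_cubic_eq_extremal_cubic:
  fixes P :: "real poly" and C r s :: real
  assumes deg: "degree P = 3" and s: "s \<in> {1/2<..<1}"
    and pell: "\<And>x. (poly P x)\<^sup>2 - 1
      = C * ((x + 1) * (x - (1 - 4 * s + 2 * s\<^sup>2)) * (x - (2 * s\<^sup>2 - 1)) * (x - 1)) * (x - r)\<^sup>2"
  shows "\<exists>c. c \<noteq> 0 \<and> P = smult c (extremal_cubic s)"
proof -
  define \<alpha> \<beta> where "\<alpha> = 1 - 4 * s + 2 * s\<^sup>2" and "\<beta> = 2 * s\<^sup>2 - 1"
  define B where "B = [:1, 1:] * [:-\<alpha>, 1:] * [:-\<beta>, 1:] * [:-1, 1:]"
  have B: "poly B x = (x + 1) * (x - \<alpha>) * (x - \<beta>) * (x - 1)" for x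
    by (simp add: B_def algebra_simps)
  have pell_poly: "P\<^sup>2 - 1 = smult C B * [:-r, 1:]\<^sup>2"
    using pell by (subst poly_eq_poly_eq_iff[symmetric]) (auto simp: B \<alpha>_def \<beta>_def algebra_simps)
  define \<epsilon> where "\<epsilon> = poly P r"
  have \<epsilon>2: "\<epsilon>\<^sup>2 = 1" using pell[of r] by (simp add: \<epsilon>_def)
  \<comment> \<open>The right side of the Pell equation has a multiple zero at \<open>r\<close>. Its
    derivative is \<open>2 P P'\<close>, and \<open>P\<close> is 1 or -1 at \<open>r\<close>, so
    \<open>r\<close> is a critical point of \<open>P\<close>.\<close>
  have "poly (pderiv (P\<^sup>2 - 1)) r = 0"
    unfolding pell_poly by (simp add: pderiv_smult pderiv_mult pderiv_power)
  then have "\<epsilon> * poly (pderiv P) r = 0"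
    by (simp add: pderiv_diff pderiv_power \<epsilon>_def)
  then have crit: "poly (pderiv P) r = 0" using \<epsilon>2 by auto
  obtain p0 p1 p2 p3 where P: "P = [:p0, p1, p2, p3:]" and p3: "p3 \<noteq> 0"
  proof
    show "P = [:coeff P 0, coeff P 1, coeff P 2, coeff P 3:]"
      using deg by (intro poly_eqI) (auto simp: coeff_pCons coeff_eq_0 eval_nat_numeral split: nat.split)
    show "coeff P 3 \<noteq> 0" using deg leading_coeff_0_iff[of P] by auto
  qed
  \<comment> \<open>Here \<open>e\<close> is the third root of \<open>P - \<epsilon>\<close> besides
    the double root \<open>r\<close>, read off from the sum of the roots.\<close>
  define e L where "e = - (2 * r + p2 / p3)" and "L = \<epsilon> / p3"
  have e: "p3 * e = - (2 * r * p3 + p2)" and L: "p3 * L = \<epsilon>"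
    using p3 by (simp_all add: e_def L_def field_simps)
  have Px: "poly P x = p3 * ((x - r)\<^sup>2 * (x - e) + L)" for x
  proof -
    have "\<epsilon> = p0 + p1 * r + p2 * r\<^sup>2 + p3 * r ^ 3" "p1 + 2 * p2 * r + 3 * p3 * r\<^sup>2 = 0"
      using crit by (simp_all add: \<epsilon>_def P pderiv_pCons algebra_simps eval_nat_numeral)
    moreover have "poly P x = p0 + p1 * x + p2 * x\<^sup>2 + p3 * x ^ 3"
      by (simp add: P algebra_simps eval_nat_numeral)
    ultimately show ?thesis using e L by algebra
  qed
  define A where "A = [:-e, 1:] * ([:-r, 1:]\<^sup>2 * [:-e, 1:] + [:2 * L:])"
  have A: "poly A x = (x - e) * ((x - r)\<^sup>2 * (x - e) + 2 * L)" for x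
    by (simp add: A_def algebra_simps)
  \<comment> \<open>Hence both sides of the Pell equation have the double root \<open>r\<close>; the quartics that remain after
    cancelling it show that the third root \<open>e\<close> of \<open>P - \<epsilon>\<close> is an endpoint of the two intervals.\<close>
  have "poly (smult (p3\<^sup>2) A * [:-r, 1:]\<^sup>2) x = poly (P\<^sup>2 - 1) x" for x
  proof -
    have "poly (smult (p3\<^sup>2) A * [:-r, 1:]\<^sup>2) x
        = p3\<^sup>2 * ((x - e) * ((x - r)\<^sup>2 * (x - e) + 2 * L)) * (x - r)\<^sup>2"
      by (simp add: A)
    also have "\<dots> = (poly P x)\<^sup>2 - 1"
    proof -
      have "p3\<^sup>2 * L\<^sup>2 = 1" using L \<epsilon>2 by (simp flip: power_mult_distrib)
      then show ?thesis unfolding Px by algebra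
    qed
    finally show ?thesis by simp
  qed
  then have "smult (p3\<^sup>2) A * [:-r, 1:]\<^sup>2 = smult C B * [:-r, 1:]\<^sup>2"
    unfolding pell_poly[symmetric] by (subst poly_eq_poly_eq_iff[symmetric]) auto
  then have AB': "smult (p3\<^sup>2) A = smult C B" by (subst (asm) mult_right_cancel) auto
  have "lead_coeff A = 1" by (simp add: A_def lead_coeff_mult lead_coeff_add_le power2_eq_square)
  moreover have "lead_coeff B = 1" by (simp add: B_def lead_coeff_mult)
  ultimately have "p3\<^sup>2 = C" using arg_cong[OF AB', of lead_coeff] by (simp only: lead_coeff_smult mult_1_right)
  then have AB: "poly A x = poly B x" for x
    using arg_cong[OF AB', of "\<lambda>p. poly p x"] p3 by auto
  have s': "1/2 < s" "s < 1" using s by auto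
  have s2: "s\<^sup>2 < 1" using s' by (simp add: power_less_one_iff)
  have lt: "-1 < \<alpha>" "\<alpha> < \<beta>" "\<beta> < 1"
  proof -
    have "0 < (1 - s)\<^sup>2" using s' by simp
    then show "-1 < \<alpha>" by (simp add: \<alpha>_def power2_eq_square algebra_simps)
  qed (use s' s2 in \<open>auto simp: \<alpha>_def \<beta>_def\<close>)
  have factor: "(x - e) * ((x - r)\<^sup>2 * (x - e) + 2 * L) = (x - (-1)) * (x - \<alpha>) * (x - \<beta>) * (x - 1)" for x
    using AB[of x] unfolding A B by simp
  consider "e = -1" | "e = \<alpha>" | "e = \<beta>" | "e = 1" using factor[of e] by auto
  then have "e = -1"
  \<comment> \<open>For \<alpha> and \<beta> one of the three remaining differences has the opposite
    sign to the other two, which the symmetric identity forbids. For 1 all signs agree, and the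
    values of \<alpha> and \<beta> in terms of \<open>s\<close> decide.\<close>
  proof cases
    case 2
    have "(x - e) * ((x - r)\<^sup>2 * (x - e) + 2 * L) = (x - e) * ((x - (-1)) * (x - \<beta>) * (x - 1))" for x
      unfolding factor[of x] by (simp add: 2)
    from monic_quartic_factor_with_double_root(3)[OF this]
    have "(-1 - e)\<^sup>2 + (\<beta> - 1)\<^sup>2 = 2 * ((-1 - e) * ((\<beta> - e) + (1 - e)))" by algebra
    moreover have "(-1 - e) * ((\<beta> - e) + (1 - e)) < 0" using 2 lt by (intro mult_neg_pos) auto
    ultimately show ?thesis using zero_le_power2[of "-1 - e"] zero_le_power2[of "\<beta> - 1"] by linarith
  next
    case 3
    have "(x - e) * ((x - r)\<^sup>2 * (x - e) + 2 * L) = (x - e) * ((x - (-1)) * (x - \<alpha>) * (x - 1))" for x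
      unfolding factor[of x] by (simp add: 3)
    from monic_quartic_factor_with_double_root(3)[OF this]
    have "(1 - e)\<^sup>2 + (-1 - \<alpha>)\<^sup>2 = 2 * ((1 - e) * ((-1 - e) + (\<alpha> - e)))" by algebra
    moreover have "(1 - e) * ((-1 - e) + (\<alpha> - e)) < 0" using 3 lt by (intro mult_pos_neg) auto
    ultimately show ?thesis using zero_le_power2[of "1 - e"] zero_le_power2[of "-1 - \<alpha>"] by linarith
  next
    case 4
    have "(x - e) * ((x - r)\<^sup>2 * (x - e) + 2 * L) = (x - e) * ((x - (-1)) * (x - \<alpha>) * (x - \<beta>))" for x
      unfolding factor[of x] by (simp add: 4)
    from monic_quartic_factor_with_double_root(3)[OF this]
    have "32 * (s * (s - 1)) = 0" unfolding 4 \<alpha>_def \<beta>_def by algebra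
    then show ?thesis using s' by simp
  qed
  have "(x - e) * ((x - r)\<^sup>2 * (x - e) + 2 * L) = (x - e) * ((x - \<alpha>) * (x - \<beta>) * (x - 1))" for x
    unfolding factor[of x] by (simp add: \<open>e = -1\<close>)
  from monic_quartic_factor_with_double_root(1,2)[OF this]
  have r: "r = 1 - 2 * s + 2 * s\<^sup>2" and L2: "2 * L + r\<^sup>2 = - (\<alpha> * \<beta>)"
    unfolding \<open>e = -1\<close> by (simp_all add: \<alpha>_def \<beta>_def)
  have "L = - extremal_norm s"
    using L2 unfolding r \<alpha>_def \<beta>_def extremal_norm_def by algebra
  then have "poly P x = poly (smult p3 (extremal_cubic s)) x" for x
    unfolding Px poly_smult poly_extremal_cubic' r \<open>e = -1\<close> by simp
  then have "P = smult p3 (extremal_cubic s)" by (simp add: poly_eq_poly_eq_iff[symmetric] fun_eq_iff)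
  with p3 show ?thesis by blast
qed

subsection \<open>Akhiezer polynomials of degree three\<close>

lemma akhiezer_poly_3_2:
  assumes s: "s \<in> {1/2<..<1}"
    and sn: "jacobi_sn \<kappa> (elliptic_K \<kappa> / 3) = s" "(jacobi_sn \<kappa> (2 * elliptic_K \<kappa> / 3))\<^sup>2 = s * (2 - s)"
  shows "akhiezer_poly 3 2 \<kappa> = extremal_cubic s"
proof (rule akhiezer_poly_eqI[OF monic_extremal_cubic])
  have set: "akhiezer_set 3 2 \<kappa> = {-1..1 - 4 * s + 2 * s\<^sup>2} \<union> {2 * s\<^sup>2 - 1..1}"
    by (simp add: akhiezer_set_def akhiezer_alpha_def akhiezer_beta_def sn)
      (simp add: algebra_simps power2_eq_square)
  show "\<bar>poly (extremal_cubic s) x\<bar> \<le> extremal_norm s" if "x \<in> akhiezer_set 3 2 \<kappa>" for x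
    using abs_extremal_cubic_le[OF s] that by (simp add: set)
  have s': "1/2 < s" "s < 1" using s by auto
  have "0 < (1 - s)\<^sup>2" using s' by simp
  then have "-1 < 1 - 4 * s + 2 * s\<^sup>2" by (simp add: power2_eq_square algebra_simps)
  moreover have "2 * s\<^sup>2 < 2 * s" using s' by (simp add: power2_eq_square)
  ultimately show "-1 < 1 - 4 * s + 2 * s\<^sup>2" "1 - 4 * s + 2 * s\<^sup>2 < 1 - 2 * s + 2 * s\<^sup>2" "1 - 2 * s + 2 * s\<^sup>2 < 1"
    "{-1, 1 - 4 * s + 2 * s\<^sup>2, 1 - 2 * s + 2 * s\<^sup>2, 1} \<subseteq> akhiezer_set 3 2 \<kappa>"
    using s' by (auto simp: set)
  show "poly (extremal_cubic s) (-1) = - extremal_norm s"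
    "poly (extremal_cubic s) (1 - 2 * s + 2 * s\<^sup>2) = - extremal_norm s"
    by (simp_all add: poly_extremal_cubic')
  show "poly (extremal_cubic s) (1 - 4 * s + 2 * s\<^sup>2) = extremal_norm s"
    "poly (extremal_cubic s) 1 = extremal_norm s"
    by (simp_all add: poly_extremal_cubic)
qed

text \<open>The set for \<open>m = 1\<close> is the mirror image of the one for
  \<open>m = 2\<close>; the outer minus sign restores the leading coefficient, since the degree is
  odd.\<close>

lemma akhiezer_poly_3_1:
  assumes s: "s \<in> {1/2<..<1}"
    and sn: "jacobi_sn \<kappa> (elliptic_K \<kappa> / 3) = s" "(jacobi_sn \<kappa> (2 * elliptic_K \<kappa> / 3))\<^sup>2 = s * (2 - s)"
  shows "akhiezer_poly 3 1 \<kappa> = - pcompose (extremal_cubic s) [:0, -1:]"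
proof (rule akhiezer_poly_eqI)
  show "monic_of_degree 3 (- pcompose (extremal_cubic s) [:0, -1:])"
  proof -
    have T: "degree (extremal_cubic s) = 3" "lead_coeff (extremal_cubic s) = 1"
      using monic_extremal_cubic[of s] by (auto simp: monic_of_degree_def)
    have "lead_coeff (pcompose (extremal_cubic s) [:0, -1:]) = -1"
      by (subst lead_coeff_comp) (use T in simp_all)
    moreover have "degree (pcompose (extremal_cubic s) [:0, -1:]) = 3"
      by (simp add: degree_pcompose T)
    ultimately show ?thesis by (simp add: monic_of_degree_def)
  qed
  have set: "akhiezer_set 3 1 \<kappa> = {-1..1 - 2 * s\<^sup>2} \<union> {- (1 - 4 * s + 2 * s\<^sup>2)..1}"
    by (simp add: akhiezer_set_def akhiezer_alpha_def akhiezer_beta_def sn)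
      (simp add: algebra_simps power2_eq_square)
  show "\<bar>poly (- pcompose (extremal_cubic s) [:0, -1:]) x\<bar> \<le> extremal_norm s"
    if "x \<in> akhiezer_set 3 1 \<kappa>" for x
    using abs_extremal_cubic_le[OF s, of "- x"] that unfolding set by (auto simp: poly_pcompose)
  have s': "1/2 < s" "s < 1" using s by auto
  have "0 < (1 - s)\<^sup>2" using s' by simp
  then have "-1 < 1 - 4 * s + 2 * s\<^sup>2" by (simp add: power2_eq_square algebra_simps)
  moreover have "2 * s\<^sup>2 < 2 * s" using s' by (simp add: power2_eq_square)
  ultimately show "-1 < - (1 - 2 * s + 2 * s\<^sup>2)" "- (1 - 2 * s + 2 * s\<^sup>2) < - (1 - 4 * s + 2 * s\<^sup>2)"
    "- (1 - 4 * s + 2 * s\<^sup>2) < 1"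
    "{-1, - (1 - 2 * s + 2 * s\<^sup>2), - (1 - 4 * s + 2 * s\<^sup>2), 1} \<subseteq> akhiezer_set 3 1 \<kappa>"
    using s' unfolding set by auto
  show "poly (- pcompose (extremal_cubic s) [:0, -1:]) 1 = extremal_norm s"
    "poly (- pcompose (extremal_cubic s) [:0, -1:]) (- (1 - 2 * s + 2 * s\<^sup>2)) = extremal_norm s"
    by (simp_all add: poly_extremal_cubic' poly_pcompose)
  show "poly (- pcompose (extremal_cubic s) [:0, -1:]) (- (1 - 4 * s + 2 * s\<^sup>2)) = - extremal_norm s"
    "poly (- pcompose (extremal_cubic s) [:0, -1:]) (-1) = - extremal_norm s"
    by (simp_all add: poly_extremal_cubic poly_pcompose)
qed

section \<open>Existence and uniqueness of the modulus\<close>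

definition sn_ratio :: "real \<Rightarrow> real" where
  "sn_ratio \<kappa> = (1 - (jacobi_sn \<kappa> (elliptic_K \<kappa> / 3))\<^sup>2) /
     ((jacobi_sn \<kappa> (2 * elliptic_K \<kappa> / 3))\<^sup>2 + (jacobi_sn \<kappa> (elliptic_K \<kappa> / 3))\<^sup>2 - 1)"

lemma sn_ratio_eq:
  assumes "jacobi_sn \<kappa> (elliptic_K \<kappa> / 3) = s" "(jacobi_sn \<kappa> (2 * elliptic_K \<kappa> / 3))\<^sup>2 = s * (2 - s)"
  shows "sn_ratio \<kappa> = (1 - s\<^sup>2) / (2 * s - 1)"
proof -
  have "s * (2 - s) + s\<^sup>2 - 1 = 2 * s - 1" by (simp add: power2_eq_square algebra_simps)
  then show ?thesis by (simp add: sn_ratio_def assms)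
qed

text \<open>In terms of \<open>s\<close> the equation is quadratic with exactly one solution in
  (1/2, 1), and \<open>s\<close> in turn determines the modulus.\<close>

lemma ex1_modulus_sn_ratio:
  fixes t :: real
  assumes "t > 0"
  shows "\<exists>!\<kappa>. \<kappa> \<in> {0<..<1} \<and> t = sn_ratio \<kappa>"
proof (rule ex_ex1I)
  define g where "g = (\<lambda>s. (1 - s\<^sup>2) - t * (2 * s - 1))"
  have "continuous_on {1/2..1} g" unfolding g_def by (intro continuous_intros)
  moreover have g: "0 < g (1/2)" "g 1 < 0" using assms by (auto simp: g_def power2_eq_square)
  ultimately obtain s where s: "1/2 \<le> s" "s \<le> 1" "g s = 0"
    using IVT2'[of g 1 0 "1/2"] by auto
  have "g (1/2) \<noteq> 0" "g 1 \<noteq> 0" using g by auto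
  with s(3) have "s \<noteq> 1/2" "s \<noteq> 1" by blast+
  with s have s': "s \<in> {1/2<..<1}" and t: "t = (1 - s\<^sup>2) / (2 * s - 1)"
    by (auto simp: g_def field_simps)
  obtain \<kappa> where "\<kappa> \<in> {0<..<1}" "\<kappa>\<^sup>2 * (s ^ 3 * (2 - s)) = 2 * s - 1"
    by (rule ex_modulus[OF s'])
  with sn_ratio_eq[OF jacobi_sn_third[OF _ s']] t
  show "\<exists>\<kappa>. \<kappa> \<in> {0<..<1} \<and> t = sn_ratio \<kappa>" by auto
next
  fix \<kappa> \<kappa>'
  assume \<kappa>: "\<kappa> \<in> {0<..<1} \<and> t = sn_ratio \<kappa>" and \<kappa>': "\<kappa>' \<in> {0<..<1} \<and> t = sn_ratio \<kappa>'"
  obtain s where s: "s \<in> {1/2<..<1}" "\<kappa>\<^sup>2 * (s ^ 3 * (2 - s)) = 2 * s - 1" "t = (1 - s\<^sup>2) / (2 * s - 1)"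
    using jacobi_sn_thirdE[of \<kappa>] sn_ratio_eq[of \<kappa>] \<kappa> by metis
  obtain u where u: "u \<in> {1/2<..<1}" "\<kappa>'\<^sup>2 * (u ^ 3 * (2 - u)) = 2 * u - 1" "t = (1 - u\<^sup>2) / (2 * u - 1)"
    using jacobi_sn_thirdE[of \<kappa>'] sn_ratio_eq[of \<kappa>'] \<kappa>' by metis
  have "t * (2 * s - 1) = 1 - s\<^sup>2" unfolding s(3) using s(1) by simp
  moreover have "t * (2 * u - 1) = 1 - u\<^sup>2" unfolding u(3) using u(1) by simp
  ultimately have "(s - u) * (s + u + 2 * t) = 0" by algebra
  then have "s = u" using s(1) u(1) assms by auto
  moreover have "0 < s ^ 3 * (2 - s)" using s(1) by simp
  ultimately have "\<kappa>\<^sup>2 = \<kappa>'\<^sup>2" using s(2) u(2) by (metis less_irrefl mult_right_cancel)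
  then show "\<kappa> = \<kappa>'" using \<kappa> \<kappa>' by (simp add: power2_eq_iff_nonneg)
qed

section \<open>Transfer of the Pell equation by affine substitution and reflection\<close>

text \<open>The affine substitution \<open>x = 2 a (1 - s\<^sup>2) y + 2 s\<^sup>2 - 1\<close> takes the branch points \<open>y = 1/\<gamma>, -1/b, 0, 1/a\<close>
  to \<open>x = -1, \<alpha>, \<beta>, 1\<close>.\<close>

lemma pell_solution3_extremal_cubic:
  fixes a b \<gamma> s :: real
  assumes ab: "a > 0" "b > 0" and \<gamma>: "\<gamma> < 0"
    and quad: "\<gamma>\<^sup>2 * (a + b)\<^sup>2 - 2 * \<gamma> * a * b * (a - b) - 3 * a\<^sup>2 * b\<^sup>2 = 0"
    and s: "s \<in> {1/2<..<1}" and ba: "b / a = (1 - s\<^sup>2) / (2 * s - 1)"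
    and p: "pell_solution3 a b \<gamma> p"
  shows "\<exists>c. c \<noteq> 0 \<and> p = smult c (pcompose (extremal_cubic s) [:2 * s\<^sup>2 - 1, 2 * a * (1 - s\<^sup>2):])"
proof -
  have s': "1/2 < s" "s < 1" "0 < s" using s by auto
  have s2: "s\<^sup>2 < 1" using s' by (simp add: power_less_one_iff)
  have b: "b * (2 * s - 1) = a * (1 - s\<^sup>2)" using ba ab s' by (simp add: field_simps)
  have \<gamma>_s: "\<gamma> * s\<^sup>2 = - (a * (1 - s\<^sup>2))"
  proof -
    \<comment> \<open>Only one root of the quadratic is negative, so it suffices that the claimed value is a root.\<close>
    define q where "q = - (a * (1 - s\<^sup>2)) / s\<^sup>2"
    have qs: "q * s\<^sup>2 = - (a * (1 - s\<^sup>2))" using s' by (simp add: q_def)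
    have "q < 0" using ab s2 s' by (simp add: q_def)
    have "q * s\<^sup>2 = - (b * (2 * s - 1))" using qs b by simp
    have absum: "(a + b) * (1 - s\<^sup>2) = b * (2 * s - s\<^sup>2)" using b by algebra
    have "s * (q * (a + b)) = - (b * (2 - s)) * a"
    proof -
      have "(s * (q * (a + b))) * s = (- (b * (2 - s)) * a) * s" using qs absum by algebra
      then show ?thesis using s' by (metis less_irrefl mult_right_cancel)
    qed
    then have q': "s * (q * (a + b)) = - (a * b * (2 - s))" by simp
    have "s\<^sup>2 * (q\<^sup>2 * (a + b)\<^sup>2 - 2 * q * a * b * (a - b) - 3 * a\<^sup>2 * b\<^sup>2) = 0"
      using q' qs b by algebra
    then have "q\<^sup>2 * (a + b)\<^sup>2 - 2 * q * a * b * (a - b) - 3 * a\<^sup>2 * b\<^sup>2 = 0" using s' by simp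
    with quad have d: "(\<gamma> - q) * ((\<gamma> + q) * (a + b)\<^sup>2 - 2 * a * b * (a - b)) = 0" by algebra
    have "\<gamma> = q"
    proof (rule ccontr)
      assume "\<gamma> \<noteq> q"
      with d have "(\<gamma> + q) * (a + b)\<^sup>2 = 2 * a * b * (a - b)" by simp
      \<comment> \<open>By Vieta the two roots have a negative product, but \<gamma> and
        \<open>q\<close> are both negative.\<close>
      then have "\<gamma> * q * (a + b)\<^sup>2 = - 3 * a\<^sup>2 * b\<^sup>2" using quad by algebra
      moreover have "0 < \<gamma> * q * (a + b)\<^sup>2" using \<gamma> \<open>q < 0\<close> ab by (simp add: mult_neg_neg)
      moreover have "0 < a\<^sup>2 * b\<^sup>2" using ab by simp
      ultimately show False by simp
    qed
    then show ?thesis using qs by simp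
  qed
  from p obtain q where deg: "degree p = 3" "degree q = 1"
    and pell: "p\<^sup>2 - [:0, 1:] * [:- (1 / a), 1:] * [:1 / b, 1:] * [:- (1 / \<gamma>), 1:] * q\<^sup>2 = 1"
    unfolding pell_solution3_def by blast
  define d m where "d = 2 * s\<^sup>2 - 1" and "m = 2 * a * (1 - s\<^sup>2)"
  have m: "m \<noteq> 0" using ab s2 by (simp add: m_def)
  define P where "P = pcompose p [:- d / m, 1 / m:]"
  define q0 q1 where "q0 = coeff q 0" and "q1 = coeff q 1"
  have q: "q = [:q0, q1:]"
    using deg(2) by (intro poly_eqI) (auto simp: q0_def q1_def coeff_pCons coeff_eq_0 split: nat.split)
  have q1: "q1 \<noteq> 0" using deg(2) leading_coeff_0_iff[of q] by (auto simp: q1_def)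
  have "degree P = 3" using deg m by (simp add: P_def degree_pcompose)
  \<comment> \<open>The four branch factors contribute \<open>m ^ 4\<close> to the denominator and
    the square of \<open>q\<close> another \<open>m\<^sup>2\<close>; the double zero is the image of
    the root of \<open>q\<close>.\<close>
  moreover have "(poly P x)\<^sup>2 - 1 = (q1\<^sup>2 / m ^ 6)
      * ((x + 1) * (x - (1 - 4 * s + 2 * s\<^sup>2)) * (x - (2 * s\<^sup>2 - 1)) * (x - 1)) * (x - (d - m * q0 / q1))\<^sup>2" for x
  proof -
    define y where "y = (x - d) / m"
    have y: "m * y = x - d" using m by (simp add: y_def)
    have lin: "poly [:0, 1:] y = y" "poly [:u, v:] y = u + v * y" "poly [:- w, 1:] y = y - w"
      "poly [:1 / b, 1:] y = y + 1 / b" for u v w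
      by simp_all
    have "(poly p y)\<^sup>2 - y * (y - 1 / a) * (y + 1 / b) * (y - 1 / \<gamma>) * (q0 + q1 * y)\<^sup>2 = 1"
      using arg_cong[OF pell, of "\<lambda>p. poly p y"]
      unfolding q poly_diff poly_mult poly_power poly_1 lin(1,3,4) lin(2)[of q0 q1] .
    then have "(poly p y)\<^sup>2 - 1 = y * (y - 1 / a) * (y + 1 / b) * (y - 1 / \<gamma>) * (q0 + q1 * y)\<^sup>2" by simp
    also have "y = (x - (2 * s\<^sup>2 - 1)) / m" by (simp add: y_def d_def)
    finally have 1: "(poly p y)\<^sup>2 - 1 = (x - (2 * s\<^sup>2 - 1)) / m * (y - 1 / a) * (y + 1 / b) * (y - 1 / \<gamma>) * (q0 + q1 * y)\<^sup>2"
      by (simp add: y_def d_def)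
    have 2: "y - 1 / a = (x - 1) / m"
    proof -
      have "m / a = 2 - 2 * s\<^sup>2" using ab by (simp add: m_def field_simps)
      then have "m * (y - 1 / a) = x - 1"
        using y by (simp add: right_diff_distrib d_def)
      then show ?thesis using m by (simp add: field_simps)
    qed
    have 3: "y + 1 / b = (x - (1 - 4 * s + 2 * s\<^sup>2)) / m"
    proof -
      have "m = 2 * b * (2 * s - 1)" using b by (simp add: m_def)
      then have "m / b = 4 * s - 2" using ab by (simp add: field_simps)
      then have "m * (y + 1 / b) = x - (1 - 4 * s + 2 * s\<^sup>2)"
        using y by (simp add: distrib_left d_def)
      then show ?thesis using m by (simp add: field_simps)
    qed
    have 4: "y - 1 / \<gamma> = (x + 1) / m"
    proof -
      have "m = - 2 * \<gamma> * s\<^sup>2" using \<gamma>_s by (simp add: m_def)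
      then have "m / \<gamma> = - 2 * s\<^sup>2" using \<gamma> by (simp add: field_simps)
      then have "m * (y - 1 / \<gamma>) = x + 1"
        using y by (simp add: right_diff_distrib d_def)
      then show ?thesis using m by (simp add: field_simps)
    qed
    have 5: "q0 + q1 * y = q1 / m * (x - (d - m * q0 / q1))"
      using m q1 by (simp add: y_def field_simps)
    have "poly P x = poly p y"
      by (simp add: P_def poly_pcompose y_def diff_divide_distrib)
    then show ?thesis using 1 unfolding 2 3 4 5
      by (simp add: power_mult_distrib power_divide eval_nat_numeral mult_ac)
  qed
  ultimately obtain c where c: "c \<noteq> 0" "P = smult c (extremal_cubic s)"
    using pell_cubic_eq_extremal_cubic[OF _ s] by blast
  have "p = pcompose P [:d, m:]"
    using m by (simp add: P_def pcompose_assoc[symmetric] pcompose_pCons pcompose_idR)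
  with c show ?thesis unfolding d_def m_def by (auto simp: pcompose_smult)
qed

text \<open>The substitution of \<open>- x\<close> exchanges the roles of \<open>1/a\<close> and
  \<open>-1/b\<close>; the signs of the four linear factors cancel.\<close>

lemma pell_solution3_reflect:
  assumes "pell_solution3 a b \<gamma> p"
  shows "pell_solution3 b a (- \<gamma>) (pcompose p [:0, -1:])"
proof -
  from assms obtain q where deg: "degree p = 3" "degree q = 1"
    and pell: "p\<^sup>2 - [:0, 1:] * [:- (1 / a), 1:] * [:1 / b, 1:] * [:- (1 / \<gamma>), 1:] * q\<^sup>2 = 1"
    unfolding pell_solution3_def by blast
  have "poly ((pcompose p [:0, -1:])\<^sup>2 - [:0, 1:] * [:- (1 / b), 1:] * [:1 / a, 1:] * [:- (1 / - \<gamma>), 1:]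
      * (pcompose q [:0, -1:])\<^sup>2) x = poly 1 x" for x
    using arg_cong[OF pell, of "\<lambda>p. poly p (- x)"] by (simp add: poly_pcompose algebra_simps)
  then have "(pcompose p [:0, -1:])\<^sup>2 - [:0, 1:] * [:- (1 / b), 1:] * [:1 / a, 1:] * [:- (1 / - \<gamma>), 1:]
      * (pcompose q [:0, -1:])\<^sup>2 = 1"
    by (simp only: poly_eq_poly_eq_iff[symmetric] fun_eq_iff) blast
  moreover have "degree (pcompose p [:0, -1:]) = 3" "degree (pcompose q [:0, -1:]) = 1"
    using deg by (simp_all add: degree_pcompose)
  ultimately show ?thesis unfolding pell_solution3_def by blast
qed

theorem proposition8p12:
  fixes a b \<gamma> :: real
  assumes "a > 0" and "b > 0" and "\<gamma> \<notin> {-b, 0, a}"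
    and "trajectories_periodic 3 a b \<gamma>"
  shows "(\<gamma> \<in> {-b<..<0} \<longleftrightarrow>
           \<gamma> = - (a * b / (a + b)\<^sup>2 * (- a + b + 2 * sqrt (a\<^sup>2 + a * b + b\<^sup>2)))) \<and>
    (\<gamma> \<in> {-b<..<0} \<longrightarrow>
      (\<exists>!\<kappa>. \<kappa> \<in> {0<..<1} \<and>
         b / a = (1 - (jacobi_sn \<kappa> (elliptic_K \<kappa> / 3))\<^sup>2) /
           ((jacobi_sn \<kappa> (2 * elliptic_K \<kappa> / 3))\<^sup>2 + (jacobi_sn \<kappa> (elliptic_K \<kappa> / 3))\<^sup>2 - 1)) \<and>
      (\<forall>\<kappa> p. \<kappa> \<in> {0<..<1} \<and>
         b / a = (1 - (jacobi_sn \<kappa> (elliptic_K \<kappa> / 3))\<^sup>2) /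
           ((jacobi_sn \<kappa> (2 * elliptic_K \<kappa> / 3))\<^sup>2 + (jacobi_sn \<kappa> (elliptic_K \<kappa> / 3))\<^sup>2 - 1) \<and>
         pell_solution3 a b \<gamma> p \<longrightarrow>
         (\<exists>c. c \<noteq> 0 \<and> p = smult c (pcompose (akhiezer_poly 3 2 \<kappa>)
            [:2 * (jacobi_sn \<kappa> (elliptic_K \<kappa> / 3))\<^sup>2 - 1,
              2 * a * (1 - (jacobi_sn \<kappa> (elliptic_K \<kappa> / 3))\<^sup>2):])))) \<and>
    (\<gamma> \<in> {0<..<a} \<longleftrightarrow>
           \<gamma> = a * b / (a + b)\<^sup>2 * (a - b + 2 * sqrt (a\<^sup>2 + a * b + b\<^sup>2))) \<and>
    (\<gamma> \<in> {0<..<a} \<longrightarrow>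
      (\<exists>!\<kappa>. \<kappa> \<in> {0<..<1} \<and>
         b / a = ((jacobi_sn \<kappa> (2 * elliptic_K \<kappa> / 3))\<^sup>2 + (jacobi_sn \<kappa> (elliptic_K \<kappa> / 3))\<^sup>2 - 1) /
           (1 - (jacobi_sn \<kappa> (elliptic_K \<kappa> / 3))\<^sup>2)) \<and>
      (\<forall>\<kappa> p. \<kappa> \<in> {0<..<1} \<and>
         b / a = ((jacobi_sn \<kappa> (2 * elliptic_K \<kappa> / 3))\<^sup>2 + (jacobi_sn \<kappa> (elliptic_K \<kappa> / 3))\<^sup>2 - 1) /
           (1 - (jacobi_sn \<kappa> (elliptic_K \<kappa> / 3))\<^sup>2) \<and>
         pell_solution3 a b \<gamma> p \<longrightarrow>
         (\<exists>c. c \<noteq> 0 \<and> p = smult c (pcompose (akhiezer_poly 3 1 \<kappa>)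
            [:1 - 2 * (jacobi_sn \<kappa> (elliptic_K \<kappa> / 3))\<^sup>2,
              2 * b * (1 - (jacobi_sn \<kappa> (elliptic_K \<kappa> / 3))\<^sup>2):]))))"
proof -
  have quad: "\<gamma>\<^sup>2 * (a + b)\<^sup>2 - 2 * \<gamma> * a * b * (a - b) - 3 * a\<^sup>2 * b\<^sup>2 = 0"
    using assms by (rule periodic_caustic_quadratic)
  then have quad': "(- \<gamma>)\<^sup>2 * (b + a)\<^sup>2 - 2 * (- \<gamma>) * b * a * (b - a) - 3 * b\<^sup>2 * a\<^sup>2 = 0"
    by algebra
  have iff1: "\<gamma> \<in> {-b<..<0} \<longleftrightarrow>
      \<gamma> = - (a * b / (a + b)\<^sup>2 * (- a + b + 2 * sqrt (a\<^sup>2 + a * b + b\<^sup>2)))"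
    using caustic_quadratic_roots[OF assms(2,1) quad'] by (auto simp: algebra_simps)
  have iff2: "\<gamma> \<in> {0<..<a} \<longleftrightarrow>
      \<gamma> = a * b / (a + b)\<^sup>2 * (a - b + 2 * sqrt (a\<^sup>2 + a * b + b\<^sup>2))"
    by (rule caustic_quadratic_roots[OF assms(1,2) quad])
  have ratio: "b / a = ((jacobi_sn \<kappa> (2 * elliptic_K \<kappa> / 3))\<^sup>2 + (jacobi_sn \<kappa> (elliptic_K \<kappa> / 3))\<^sup>2 - 1) /
      (1 - (jacobi_sn \<kappa> (elliptic_K \<kappa> / 3))\<^sup>2) \<longleftrightarrow> a / b = sn_ratio \<kappa>" for \<kappa>
    unfolding sn_ratio_def by (metis inverse_divide)
  have poly1: "\<exists>c. c \<noteq> 0 \<and> p = smult c (pcompose (akhiezer_poly 3 2 \<kappa>)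
      [:2 * (jacobi_sn \<kappa> (elliptic_K \<kappa> / 3))\<^sup>2 - 1, 2 * a * (1 - (jacobi_sn \<kappa> (elliptic_K \<kappa> / 3))\<^sup>2):])"
    if \<gamma>: "\<gamma> \<in> {-b<..<0}" and k: "\<kappa> \<in> {0<..<1} \<and> b / a = sn_ratio \<kappa> \<and> pell_solution3 a b \<gamma> p" for \<kappa> p
  proof -
    obtain s where s: "s \<in> {1/2<..<1}" and sn: "jacobi_sn \<kappa> (elliptic_K \<kappa> / 3) = s"
        "(jacobi_sn \<kappa> (2 * elliptic_K \<kappa> / 3))\<^sup>2 = s * (2 - s)"
      using jacobi_sn_thirdE[of \<kappa>] k by blast
    have "akhiezer_poly 3 2 \<kappa> = extremal_cubic s"
      using akhiezer_poly_3_2[OF s sn] .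
    moreover have "\<exists>c. c \<noteq> 0 \<and> p = smult c (pcompose (extremal_cubic s) [:2 * s\<^sup>2 - 1, 2 * a * (1 - s\<^sup>2):])"
      using \<gamma> k sn_ratio_eq[OF sn] by (intro pell_solution3_extremal_cubic[OF assms(1,2) _ quad s]) auto
    ultimately show ?thesis unfolding sn(1) by simp
  qed
  have poly2: "\<exists>c. c \<noteq> 0 \<and> p = smult c (pcompose (akhiezer_poly 3 1 \<kappa>)
      [:1 - 2 * (jacobi_sn \<kappa> (elliptic_K \<kappa> / 3))\<^sup>2, 2 * b * (1 - (jacobi_sn \<kappa> (elliptic_K \<kappa> / 3))\<^sup>2):])"
    if \<gamma>: "\<gamma> \<in> {0<..<a}" and k: "\<kappa> \<in> {0<..<1} \<and> a / b = sn_ratio \<kappa> \<and> pell_solution3 a b \<gamma> p" for \<kappa> p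
  proof -
    obtain s where s: "s \<in> {1/2<..<1}" and sn: "jacobi_sn \<kappa> (elliptic_K \<kappa> / 3) = s"
        "(jacobi_sn \<kappa> (2 * elliptic_K \<kappa> / 3))\<^sup>2 = s * (2 - s)"
      using jacobi_sn_thirdE[of \<kappa>] k by blast
    have T: "akhiezer_poly 3 1 \<kappa> = - pcompose (extremal_cubic s) [:0, -1:]"
      using akhiezer_poly_3_1[OF s sn] .
    have "\<exists>c. c \<noteq> 0 \<and> pcompose p [:0, -1:]
        = smult c (pcompose (extremal_cubic s) [:2 * s\<^sup>2 - 1, 2 * b * (1 - s\<^sup>2):])"
      using \<gamma> k sn_ratio_eq[OF sn] pell_solution3_reflect[of a b \<gamma> p]
      by (intro pell_solution3_extremal_cubic[OF assms(2,1) _ quad' s]) auto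
    then obtain c where c: "c \<noteq> 0" and p: "pcompose p [:0, -1:]
        = smult c (pcompose (extremal_cubic s) [:2 * s\<^sup>2 - 1, 2 * b * (1 - s\<^sup>2):])" by blast
    \<comment> \<open>Evaluating the reflected identity at \<open>- x\<close> recovers
      \<open>p\<close>; the outer minus sign of the reflected extremal cubic turns \<open>c\<close>
      into \<open>- c\<close>.\<close>
    have "poly p x = poly (smult (- c) (pcompose (akhiezer_poly 3 1 \<kappa>)
        [:1 - 2 * s\<^sup>2, 2 * b * (1 - s\<^sup>2):])) x" for x
      using arg_cong[OF p, of "\<lambda>p. poly p (- x)"] unfolding T by (simp add: poly_pcompose)
    then have "p = smult (- c) (pcompose (akhiezer_poly 3 1 \<kappa>) [:1 - 2 * s\<^sup>2, 2 * b * (1 - s\<^sup>2):])"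
      by (simp only: poly_eq_poly_eq_iff[symmetric] fun_eq_iff) blast
    with c show ?thesis unfolding sn(1) by (intro exI[of _ "- c"]) simp
  qed
  show ?thesis
    unfolding ratio unfolding sn_ratio_def[symmetric]
    using assms(1,2)
    by (intro conjI impI allI iff1 iff2 poly1 poly2 ex1_modulus_sn_ratio) (assumption | simp)+
qed

end
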